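(* Assume the four assumptions ($\mathbf g$-relevant Hessian boundedness, Lipschitz Hessian, Krylov subspace regularity I and II) stated in the context, let $f^\star=\min_{\mathbf x}f(\mathbf x)$, and let $$K=\left\lceil\frac{2\left(f(\mathbf x_0)-f^\star\right)}{\min\{c_1,c_2,c_3,c_4\}}\max\{\varepsilon_g^{-3/2},\varepsilon_H^{-3}\}+1\right\rceil,$$ where $$c_0=\frac{2\sigma}{\theta L_g+\sqrt{\theta^2L_g^2+2\sigma^2L_H}},\quad c_1=\rho_S\,\sigma\left(\frac{3\sigma(1-2\rho_S)}{L_H}\right)^2,\quad c_2=\rho_S\,\sigma\,c_0^2,$$ $$c_3=\rho_N\,\omega^{3/2}\sqrt{\frac{6(1-\rho_N)}{L_H}},\qquad c_4=\frac{9\rho_C(1-\rho_C)^2}{16L_H^2}.$$ Then, with probability one, after at most $K$ iterations of the second-order Newton-MR method (Algorithm B in the context), the approximate second-order optimality condition $\|\nabla f(\mathbf x_k)\|\le\varepsilon_g$ and $\lambda_{\min}(\nabla^2f(\mathbf x_k))\ge-\varepsilon_H$ is satisfied.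
   Context: Setting: $f:\mathbb R^d\to\mathbb R$ is twice continuously differentiable and attains its minimum; $\mathbf g(\mathbf x)=\nabla f(\mathbf x)$, $\mathbf H(\mathbf x)=\nabla^2 f(\mathbf x)$, $\mathbf g_k=\mathbf g(\mathbf x_k)$, $\mathbf H_k=\mathbf H(\mathbf x_k)$; $\|\cdot\|$ is the Euclidean/spectral norm. Exact arithmetic is assumed. MINRES. For a symmetric $\mathbf H$ and $\mathbf g\ne\mathbf 0$ let $\mathcal K_t(\mathbf H,\mathbf g)=\mathrm{Span}\{\mathbf g,\mathbf H\mathbf g,\dots,\mathbf H^{t-1}\mathbf g\}$; the grade $g$ of $\mathbf g$ with respect to $\mathbf H$ is the integer with $\dim\mathcal K_t=\min\{t,g\}$ for all $t\ge1$. The MINRES iterates are $\mathbf s_0=\mathbf 0$, $\mathbf s_t=\arg\min_{\mathbf s\in\mathcal K_t(\mathbf H,\mathbf g)}\|\mathbf H\mathbf s+\mathbf g\|^2$ (if the minimizer is not unique, which can only occur at $t=g$ with $\mathbf g\notin\mathrm{Range}(\mathbf H)$, then $\mathbf s_g=\mathbf s_{g-1}$), with residuals $\mathbf r_t=-\mathbf g-\mathbf H\mathbf s_t$. The NPC (nonpositive curvature) condition is detected at iteration $t$ if $\mathbf r_{t-1}\neq\mathbf 0$ and $\langle\mathbf r_{t-1},\mathbf H\mathbf r_{t-1}\rangle\le0$. The procedure MINRES$(\mathbf H,\mathbf g,\eta)$ does, for $t=1,2,\dots$: if the NPC condition is detected at iteration $t$, return $\mathbf d=\mathbf r_{t-1}$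 with flag `NPC'; otherwise, if $\|\mathbf H\mathbf r_{t-1}\|\le\eta\|\mathbf H\mathbf s_{t-1}\|$, return $\mathbf d=\mathbf s_{t-1}$ with flag `SOL'; otherwise continue. Algorithm B (second-order Newton-MR). Inputs: $\mathbf x_0\in\mathbb R^d$, $0<\varepsilon_g\le1$, $0<\varepsilon_H\le1$, $\theta>0$, line-search parameters $0<\rho_S<1/2$, $0<\rho_N<1$, $0<\rho_C<1$. For $k=0,1,\dots$: (a) If $\|\mathbf g_k\|>\varepsilon_g$: call MINRES$(\mathbf H_k,\mathbf g_k,\theta\sqrt{\varepsilon_g})$ to get $\mathbf d_k$ and a flag. If `SOL', $\alpha_k$ is the largest $0<\alpha\le1$ with $f(\mathbf x_k+\alpha\mathbf d_k)\le f(\mathbf x_k)+\rho_S\,\alpha\langle\mathbf g_k,\mathbf d_k\rangle$; if `NPC', $\alpha_k$ is the largest $\alpha>0$ with $f(\mathbf x_k+\alpha\mathbf d_k)\le f(\mathbf x_k)+\rho_N\,\alpha\langle\mathbf g_k,\mathbf d_k\rangle$. (b) If $\|\mathbf g_k\|\le\varepsilon_g$: draw $\tilde{\mathbf g}$ from the uniform distribution on the unit sphere (a fresh draw each time) and call MINRES$(\mathbf H_k+\tfrac{\varepsilon_H}{2}\mathbf I,\tilde{\mathbf g},0)$. If the flag is `SOL', terminate. If it is `NPC' with returned vector $\mathbf r$, set $\mathbf d_k=-\mathrm{Sign}(\langle\mathbf g_k,\mathbf r\rangle)\,\mathbf r/\|\mathbf r\|$ (with $\mathrm{Sign}(0)$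 chosen arbitrarily as $\pm1$), and let $\alpha_k$ be the largest $\alpha>0$ with $f(\mathbf x_k+\alpha\mathbf d_k)\le f(\mathbf x_k)+\tfrac12\rho_C\,\alpha^2\langle\mathbf d_k,\mathbf H_k\mathbf d_k\rangle$. Set $\mathbf x_{k+1}=\mathbf x_k+\alpha_k\mathbf d_k$. Assumptions. (1) $\mathbf g$-relevant Hessian boundedness: an eigenvalue $\lambda$ of $\mathbf H$ is $\mathbf g$-relevant if $\mathbf g$ is not orthogonal to $\mathrm{Null}(\mathbf H-\lambda\mathbf I)$. Let $\mathbf U$ be a matrix whose columns form an orthonormal basis of eigenvectors for the sum of the eigenspaces of all nonzero $\mathbf g$-relevant eigenvalues. There is $0\le L_g<\infty$ with $\|\mathbf U^\top\mathbf H(\mathbf x)\mathbf U\|\le L_g$ for all $\mathbf x\in\mathbb R^d$. (2) Lipschitz Hessian: $\|\nabla^2f(\mathbf x)-\nabla^2f(\mathbf y)\|\le L_H\|\mathbf x-\mathbf y\|$ for all $\mathbf x,\mathbf y$, with $0<L_H<\infty$. (3) Krylov subspace regularity I: there is $\sigma>0$ such that for every $\mathbf x$ and every $t\le g$, if the NPC condition has not been detected at iterations $1,\dots,t$ of MINRES applied to $\mathbf H(\mathbf x),\mathbf g(\mathbf x)$, then $\langle\mathbf s,\mathbf H(\mathbf x)\mathbf s\rangle\ge\sigma\|\mathbf s\|^2$ for all $\mathbf s\in\mathcal K_t(\mathbf H(\mathbf x),\mathbf g(\mathbf x))$. (4) Krylov subspace regularity II: there is $\omega>0$ such that for every iterate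 $\mathbf x_k$ of the algorithm at which the MINRES call in (a) returns `NPC', $\|\mathbf d_k\|\ge\omega\|\mathbf g_k\|$. *)

theory Defs
  imports "HOL-Probability.Probability"
begin

definition eigenspace :: "real^'d^'d \<Rightarrow> real \<Rightarrow> (real^'d) set" where
  "eigenspace A \<mu> = {v. (A - mat \<mu>) *v v = 0}"

definition eigenvalues :: "real^'d^'d \<Rightarrow> real set" where
  "eigenvalues A = {\<mu>. \<exists>v. v \<noteq> 0 \<and> A *v v = \<mu> *\<^sub>R v}"

text \<open>Meaningful for symmetric matrices, whose set of real eigenvalues is finite and nonempty.\<close>

definition lambda_min :: "real^'d^'d \<Rightarrow> real" where
  "lambda_min A = Min (eigenvalues A)"

definition relevant_eigenvalues :: "real^'d^'d \<Rightarrow> real^'d \<Rightarrow> real set" where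
  "relevant_eigenvalues A b = {\<mu> \<in> eigenvalues A. \<not> (\<forall>v \<in> eigenspace A \<mu>. b \<bullet> v = 0)}"

definition spectral_norm :: "real^'d^'d \<Rightarrow> real" where
  "spectral_norm A = onorm (\<lambda>v. A *v v)"

text \<open>
  The number of columns of the eigenbasis matrix varies with the point, so it cannot be a type.
  Its columns are the columns of \<open>U\<close> with index in \<open>J\<close>; all other columns of the
  square matrix \<open>U\<close> are zero. This padding only adds zero rows and columns to
  \<open>transpose U ** A ** U\<close> and so leaves its spectral norm unchanged (the norm is 0 if
  \<open>J\<close> is empty).
\<close>

definition relevant_eigenbasis ::
    "real^'d^'d \<Rightarrow> real^'d \<Rightarrow> 'd set \<Rightarrow> real^'d^'d \<Rightarrow> bool" where
  "relevant_eigenbasis A b J U \<longleftrightarrow>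
     (\<forall>j\<in>J. \<exists>\<mu>. column j U \<in> eigenspace A \<mu>) \<and>
     (\<forall>i\<in>J. \<forall>j\<in>J. column i U \<bullet> column j U = (if i = j then 1 else 0)) \<and>
     (\<forall>j. j \<notin> J \<longrightarrow> column j U = 0) \<and>
     span ((\<lambda>j. column j U) ` J) =
       span (\<Union>\<mu> \<in> relevant_eigenvalues A b - {0}. eigenspace A \<mu>)"

definition krylov :: "real^'d^'d \<Rightarrow> real^'d \<Rightarrow> nat \<Rightarrow> (real^'d) set" where
  "krylov A b t = span {((\<lambda>v. A *v v) ^^ i) b | i. i < t}"

definition grade :: "real^'d^'d \<Rightarrow> real^'d \<Rightarrow> nat" where
  "grade A b = (THE m. \<forall>t\<ge>1. dim (krylov A b t) = min t m)"

definition minres_minimizer :: "real^'d^'d \<Rightarrow> real^'d \<Rightarrow> nat \<Rightarrow> real^'d \<Rightarrow> bool" where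
  "minres_minimizer A b t s \<longleftrightarrow>
     is_arg_min (\<lambda>s. (norm (A *v s + b))\<^sup>2) (\<lambda>s. s \<in> krylov A b t) s"

fun minres_iterate :: "real^'d^'d \<Rightarrow> real^'d \<Rightarrow> nat \<Rightarrow> real^'d" where
  "minres_iterate A b 0 = 0"
| "minres_iterate A b (Suc t) =
     (if \<exists>!s. minres_minimizer A b (Suc t) s
      then THE s. minres_minimizer A b (Suc t) s
      else minres_iterate A b t)"

definition minres_residual :: "real^'d^'d \<Rightarrow> real^'d \<Rightarrow> nat \<Rightarrow> real^'d" where
  "minres_residual A b t = - b - A *v minres_iterate A b t"

text \<open>Both tests below are used only for iterations \<open>t \<ge> 1\<close>.\<close>

definition npc_detected :: "real^'d^'d \<Rightarrow> real^'d \<Rightarrow> nat \<Rightarrow> bool" where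
  "npc_detected A b t \<longleftrightarrow>
     minres_residual A b (t - 1) \<noteq> 0 \<and>
     minres_residual A b (t - 1) \<bullet> (A *v minres_residual A b (t - 1)) \<le> 0"

definition sol_accepted :: "real^'d^'d \<Rightarrow> real^'d \<Rightarrow> real \<Rightarrow> nat \<Rightarrow> bool" where
  "sol_accepted A b \<eta> t \<longleftrightarrow>
     norm (A *v minres_residual A b (t - 1)) \<le> \<eta> * norm (A *v minres_iterate A b (t - 1))"

datatype minres_flag = NPC | SOL

definition minres_returns ::
    "real^'d^'d \<Rightarrow> real^'d \<Rightarrow> real \<Rightarrow> minres_flag \<Rightarrow> real^'d \<Rightarrow> bool" where
  "minres_returns A b \<eta> flag d \<longleftrightarrow>
     (\<exists>t\<ge>1. (\<forall>j. 1 \<le> j \<and> j < t \<longrightarrow> \<not> npc_detected A b j \<and> \<not> sol_accepted A b \<eta> j) \<and>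
        (npc_detected A b t \<and> flag = NPC \<and> d = minres_residual A b (t - 1) \<or>
         \<not> npc_detected A b t \<and> sol_accepted A b \<eta> t \<and> flag = SOL \<and>
           d = minres_iterate A b (t - 1)))"

definition is_largest :: "(real \<Rightarrow> bool) \<Rightarrow> real \<Rightarrow> bool" where
  "is_largest P a \<longleftrightarrow> P a \<and> (\<forall>b. P b \<longrightarrow> b \<le> a)"

definition gradient_step ::
    "(real^'d \<Rightarrow> real) \<Rightarrow> (real^'d \<Rightarrow> real^'d) \<Rightarrow> (real^'d \<Rightarrow> real^'d^'d) \<Rightarrow>
     real \<Rightarrow> real \<Rightarrow> real \<Rightarrow> real \<Rightarrow> real^'d \<Rightarrow> real^'d \<Rightarrow> bool" where
  "gradient_step f g H \<epsilon>\<^sub>g \<theta> \<rho>\<^sub>S \<rho>\<^sub>N x x' \<longleftrightarrow>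
     (\<exists>flag d \<alpha>.
        minres_returns (H x) (g x) (\<theta> * sqrt \<epsilon>\<^sub>g) flag d \<and>
        (case flag of
           SOL \<Rightarrow> is_largest (\<lambda>a. 0 < a \<and> a \<le> 1 \<and>
                    f (x + a *\<^sub>R d) \<le> f x + \<rho>\<^sub>S * a * (g x \<bullet> d)) \<alpha>
         | NPC \<Rightarrow> is_largest (\<lambda>a. 0 < a \<and>
                    f (x + a *\<^sub>R d) \<le> f x + \<rho>\<^sub>N * a * (g x \<bullet> d)) \<alpha>) \<and>
        x' = x + \<alpha> *\<^sub>R d)"

text \<open>The sign \<open>s\<close> is an arbitrary one of \<open>1\<close> and \<open>-1\<close> if \<open>g x \<bullet> r = 0\<close>.\<close>

definition curvature_step ::
    "(real^'d \<Rightarrow> real) \<Rightarrow> (real^'d \<Rightarrow> real^'d) \<Rightarrow> (real^'d \<Rightarrow> real^'d^'d) \<Rightarrow>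
     real \<Rightarrow> real \<Rightarrow> real^'d \<Rightarrow> real^'d \<Rightarrow> real^'d \<Rightarrow> bool" where
  "curvature_step f g H \<epsilon>\<^sub>H \<rho>\<^sub>C x u x' \<longleftrightarrow>
     (\<exists>r s d \<alpha>.
        minres_returns (H x + mat (\<epsilon>\<^sub>H / 2)) u 0 NPC r \<and>
        s \<in> {-1, 1} \<and> (g x \<bullet> r \<noteq> 0 \<longrightarrow> s = sgn (g x \<bullet> r)) \<and>
        d = - (s / norm r) *\<^sub>R r \<and>
        is_largest (\<lambda>a. 0 < a \<and>
          f (x + a *\<^sub>R d) \<le> f x + 1/2 * \<rho>\<^sub>C * a\<^sup>2 * (d \<bullet> (H x *v d))) \<alpha> \<and>
        x' = x + \<alpha> *\<^sub>R d)"

definition newton_mr_step ::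
    "(real^'d \<Rightarrow> real) \<Rightarrow> (real^'d \<Rightarrow> real^'d) \<Rightarrow> (real^'d \<Rightarrow> real^'d^'d) \<Rightarrow>
     real \<Rightarrow> real \<Rightarrow> real \<Rightarrow> real \<Rightarrow> real \<Rightarrow> real \<Rightarrow> real^'d \<Rightarrow> real^'d \<Rightarrow> real^'d \<Rightarrow> bool" where
  "newton_mr_step f g H \<epsilon>\<^sub>g \<epsilon>\<^sub>H \<theta> \<rho>\<^sub>S \<rho>\<^sub>N \<rho>\<^sub>C x u x' \<longleftrightarrow>
     (if norm (g x) > \<epsilon>\<^sub>g then gradient_step f g H \<epsilon>\<^sub>g \<theta> \<rho>\<^sub>S \<rho>\<^sub>N x x'
      else curvature_step f g H \<epsilon>\<^sub>H \<rho>\<^sub>C x u x')"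

definition newton_mr_terminates ::
    "(real^'d \<Rightarrow> real^'d) \<Rightarrow> (real^'d \<Rightarrow> real^'d^'d) \<Rightarrow>
     real \<Rightarrow> real \<Rightarrow> real^'d \<Rightarrow> real^'d \<Rightarrow> bool" where
  "newton_mr_terminates g H \<epsilon>\<^sub>g \<epsilon>\<^sub>H x u \<longleftrightarrow>
     norm (g x) \<le> \<epsilon>\<^sub>g \<and> (\<exists>d. minres_returns (H x + mat (\<epsilon>\<^sub>H / 2)) u 0 SOL d)"

text \<open>
  A run is a sequence \<open>x\<close> driven by the draws \<open>u\<close>; the draw \<open>u k\<close> is
  used at iteration \<open>k\<close> only if the gradient is small there. Once the method has terminated
  there are no further iterates, and the remaining entries of \<open>x\<close> are unconstrained.
\<close>

definition is_iterate ::
    "(real^'d \<Rightarrow> real^'d) \<Rightarrow> (real^'d \<Rightarrow> real^'d^'d) \<Rightarrow>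
     real \<Rightarrow> real \<Rightarrow> (nat \<Rightarrow> real^'d) \<Rightarrow> (nat \<Rightarrow> real^'d) \<Rightarrow> nat \<Rightarrow> bool" where
  "is_iterate g H \<epsilon>\<^sub>g \<epsilon>\<^sub>H u x k \<longleftrightarrow>
     (\<forall>j<k. \<not> newton_mr_terminates g H \<epsilon>\<^sub>g \<epsilon>\<^sub>H (x j) (u j))"

definition newton_mr_run ::
    "(real^'d \<Rightarrow> real) \<Rightarrow> (real^'d \<Rightarrow> real^'d) \<Rightarrow> (real^'d \<Rightarrow> real^'d^'d) \<Rightarrow>
     real \<Rightarrow> real \<Rightarrow> real \<Rightarrow> real \<Rightarrow> real \<Rightarrow> real \<Rightarrow>
     real^'d \<Rightarrow> (nat \<Rightarrow> real^'d) \<Rightarrow> (nat \<Rightarrow> real^'d) \<Rightarrow> bool" where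
  "newton_mr_run f g H \<epsilon>\<^sub>g \<epsilon>\<^sub>H \<theta> \<rho>\<^sub>S \<rho>\<^sub>N \<rho>\<^sub>C x\<^sub>0 u x \<longleftrightarrow>
     x 0 = x\<^sub>0 \<and>
     (\<forall>k. is_iterate g H \<epsilon>\<^sub>g \<epsilon>\<^sub>H u x (Suc k) \<longrightarrow>
        newton_mr_step f g H \<epsilon>\<^sub>g \<epsilon>\<^sub>H \<theta> \<rho>\<^sub>S \<rho>\<^sub>N \<rho>\<^sub>C (x k) (u k) (x (Suc k)))"

text \<open>
  The uniform distribution on the unit sphere: the radial projection of the uniform
  distribution on the unit ball (the origin, mapped to itself, is a null set).
\<close>

definition uniform_sphere :: "(real^'d) measure" where
  "uniform_sphere = distr (uniform_measure lborel (ball 0 1)) borel (\<lambda>v. v /\<^sub>R norm v)"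

text \<open>The norm below does not depend on the choice of the eigenbasis.\<close>

definition relevant_hessian_bounded ::
    "(real^'d \<Rightarrow> real^'d) \<Rightarrow> (real^'d \<Rightarrow> real^'d^'d) \<Rightarrow> real \<Rightarrow> bool" where
  "relevant_hessian_bounded g H L \<longleftrightarrow>
     (\<forall>x. \<exists>J U. relevant_eigenbasis (H x) (g x) J U \<and>
        spectral_norm (transpose U ** H x ** U) \<le> L)"

definition hessian_lipschitz :: "(real^'d \<Rightarrow> real^'d^'d) \<Rightarrow> real \<Rightarrow> bool" where
  "hessian_lipschitz H L \<longleftrightarrow> (\<forall>x y. spectral_norm (H x - H y) \<le> L * norm (x - y))"

definition krylov_regular_I ::
    "(real^'d \<Rightarrow> real^'d) \<Rightarrow> (real^'d \<Rightarrow> real^'d^'d) \<Rightarrow> real \<Rightarrow> bool" where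
  "krylov_regular_I g H \<sigma> \<longleftrightarrow>
     (\<forall>x. \<forall>t \<le> grade (H x) (g x).
        (\<forall>i\<in>{1..t}. \<not> npc_detected (H x) (g x) i) \<longrightarrow>
        (\<forall>s \<in> krylov (H x) (g x) t. s \<bullet> (H x *v s) \<ge> \<sigma> * (norm s)\<^sup>2))"

definition krylov_regular_II ::
    "(real^'d \<Rightarrow> real^'d) \<Rightarrow> (real^'d \<Rightarrow> real^'d^'d) \<Rightarrow> real \<Rightarrow> real \<Rightarrow> real \<Rightarrow> real \<Rightarrow>
     (nat \<Rightarrow> real^'d) \<Rightarrow> (nat \<Rightarrow> real^'d) \<Rightarrow> bool" where
  "krylov_regular_II g H \<epsilon>\<^sub>g \<epsilon>\<^sub>H \<theta> \<omega> u x \<longleftrightarrow>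
     (\<forall>k d. is_iterate g H \<epsilon>\<^sub>g \<epsilon>\<^sub>H u x k \<and> norm (g (x k)) > \<epsilon>\<^sub>g \<and>
        minres_returns (H (x k)) (g (x k)) (\<theta> * sqrt \<epsilon>\<^sub>g) NPC d \<longrightarrow>
        norm d \<ge> \<omega> * norm (g (x k)))"

end

theory Submission
  imports Defs
begin

text \<open>
  The objective is bounded below, and it drops by at least
  \<open>\<delta> = min {c\<^sub>1, c\<^sub>2, c\<^sub>3, c\<^sub>4} * min (\<epsilon>\<^sub>g powr (3/2)) (\<epsilon>\<^sub>H ^ 3)\<close> in at least one of any
  two consecutive iterations before the sought point; this bounds the number of iterations.

  A Hessian with Lipschitz constant \<open>L\<close> gives the cubic bound
  \<open>f (x + d) \<le> f x + g x \<bullet> d + 1/2 * (d \<bullet> H x d) + L/6 * norm d ^ 3\<close> (\<open>value_taylor\<close>). For each kind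
  of step a trial step length that makes the cubic term harmless passes the line search, so the
  largest accepted one is at least as long and its decrease at least as large. For a direction of
  nonpositive curvature, with small or with large gradient, this already gives \<open>\<delta>\<close>
  (\<open>NPC_decrease\<close>, \<open>curvature_decrease\<close>). For an approximate solution \<open>s\<close> of the Newton system
  either the accepted step length is below one, or the unit step is taken; then the gradient at
  the new point is bounded by a quadratic in \<open>norm s\<close>, so either \<open>s\<close> is long and the decrease
  is large, or the new gradient is small and the next iteration follows negative curvature
  (\<open>gradient_step_progress\<close>).

  What these estimates use about MINRES holds because, as long as no nonpositive curvature has
  shown up, its iterates are those of the conjugate residual recursion
  (\<open>minres_iterate_eq_cr\<close>). The invariants of that recursion (\<open>cr_invariants\<close>) yield that the matrix
  \<open>A\<close> is positive definite on the Krylov space explored so far, that a residual \<open>r\<close> satisfies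
  \<open>b \<bullet> r = - (norm r)\<^sup>2\<close>, and that an iterate \<open>s\<close> satisfies \<open>b \<bullet> s \<le> - (s \<bullet> A s)\<close>.

  Chance enters only through the termination test. If the test is passed, the shifted
  Hessian is positive definite on the whole Krylov space of the random vector; if its smallest
  eigenvalue were negative, the random vector would have to be orthogonal to a corresponding
  eigenvector (\<open>krylov_psd_imp_orthogonal\<close>), which for a fixed point \<open>x\<close> has probability zero. The
  iterate, however, depends on the earlier draws, and neither its measurability nor its independence
  of later draws is given: the sign of a step along a direction orthogonal to the gradient is
  arbitrary. But every step is one of countably many measurable functions of the current
  point and the current draw (\<open>countable_step_maps\<close>), so the \<open>k\<close>-th iterate takes one of
  countably many values that are measurable functions of the earlier draws, and Fubini's theorem
  applies to each of them (\<open>AE_run_avoids\<close>).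
\<close>

section \<open>Krylov spaces\<close>

lemma matrix_vector_power_Suc:
  fixes A :: "real^'d^'d"
  shows "((\<lambda>v. A *v v) ^^ Suc i) b = A *v (((\<lambda>v. A *v v) ^^ i) b)"
  by simp

lemma subspace_krylov: "subspace (krylov A b t)"
  by (simp add: krylov_def)

lemma krylov_mono: "i \<le> j \<Longrightarrow> krylov A b i \<subseteq> krylov A b j"
  unfolding krylov_def by (intro span_mono) auto

lemma krylov_0 [simp]: "krylov A b 0 = {0}"
  by (simp add: krylov_def)

lemma start_in_krylov: "b \<in> krylov A b (Suc t)"
proof -
  have "((\<lambda>v. A *v v) ^^ 0) b \<in> {((\<lambda>v. A *v v) ^^ i) b | i. i < Suc t}" by blast
  then show ?thesis unfolding krylov_def by (simp add: span_base)
qed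

lemma krylov_Suc: "krylov A b (Suc t) = span (insert (((\<lambda>v. A *v v) ^^ t) b) (krylov A b t))"
proof -
  have "{((\<lambda>v. A *v v) ^^ i) b | i. i < Suc t}
      = insert (((\<lambda>v. A *v v) ^^ t) b) {((\<lambda>v. A *v v) ^^ i) b | i. i < t}"
    by (auto simp: less_Suc_eq)
  then show ?thesis
    unfolding krylov_def by (simp add: span_insert span_span)
qed

lemma matrix_image_krylov: "v \<in> krylov A b t \<Longrightarrow> A *v v \<in> krylov A b (Suc t)"
proof -
  let ?S = "{((\<lambda>v. A *v v) ^^ i) b | i. i < t}"
  assume "v \<in> krylov A b t"
  then have "A *v v \<in> span ((\<lambda>v. A *v v) ` ?S)"
    unfolding krylov_def by (subst span_linear_image) (auto simp: matrix_vector_mul_linear)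
  moreover have "(\<lambda>v. A *v v) ` ?S \<subseteq> {((\<lambda>v. A *v v) ^^ i) b | i. i < Suc t}"
  proof
    fix y assume "y \<in> (\<lambda>v. A *v v) ` ?S"
    then obtain i where "i < t" "y = ((\<lambda>v. A *v v) ^^ Suc i) b" by auto
    then show "y \<in> {((\<lambda>v. A *v v) ^^ i) b | i. i < Suc t}"
      by (intro CollectI exI[of _ "Suc i"]) auto
  qed
  ultimately show ?thesis unfolding krylov_def using span_mono by blast
qed

text \<open>
  If one step adds nothing, the space is invariant under \<open>A\<close> and no later step adds anything.
\<close>

lemma krylov_stationary:
  assumes "krylov A b (Suc n) \<subseteq> krylov A b n" and "n \<le> m"
  shows "krylov A b m = krylov A b n"
  using assms(2)
proof (induction rule: dec_induct)
  case base
  then show ?case by simp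
next
  case (step m)
  have "((\<lambda>v. A *v v) ^^ m) b \<in> krylov A b (Suc n)"
  proof (cases m)
    case 0
    then show ?thesis by (simp add: start_in_krylov)
  next
    case (Suc j)
    have "((\<lambda>v. A *v v) ^^ j) b \<in> krylov A b (Suc j)"
      unfolding krylov_def by (intro span_base) blast
    then have "((\<lambda>v. A *v v) ^^ j) b \<in> krylov A b n"
      using step.IH Suc by simp
    from matrix_image_krylov[OF this] show ?thesis by (simp add: Suc)
  qed
  then have "((\<lambda>v. A *v v) ^^ m) b \<in> krylov A b n" using assms(1) by blast
  then have "krylov A b (Suc m) = span (krylov A b n)"
    by (simp add: krylov_Suc step.IH insert_absorb)
  then show ?case by (simp add: subspace_krylov span_eq_iff[THEN iffD2])
qed

lemma mem_span_insert_subspace: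
  assumes "subspace S" "v \<in> span (insert a S)"
  obtains c w where "w \<in> S" "v = c *\<^sub>R a + w"
proof -
  obtain k where "v - k *\<^sub>R a \<in> span S" using assms(2) by (auto simp: span_insert)
  then have "v - k *\<^sub>R a \<in> S" using assms(1) by (simp add: span_eq_iff[THEN iffD2])
  then show ?thesis using that[of "v - k *\<^sub>R a" k] by simp
qed

section \<open>The conjugate residual recursion\<close>

text \<open>
  The state is the pair of the iterate \<open>s\<close> and the search direction \<open>p\<close>. Once the residual \<open>r\<close>
  vanishes, both quotients are \<open>0\<close> by the convention for division by zero, so the recursion is
  stationary. Each state is a composition of arithmetic operations on \<open>A\<close> and \<open>b\<close>, hence measurable
  in them.
\<close>

fun cr_state :: "real^'d^'d \<Rightarrow> real^'d \<Rightarrow> nat \<Rightarrow> (real^'d) \<times> (real^'d)" where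
  "cr_state A b 0 = (0, - b)"
| "cr_state A b (Suc n) =
     (let s = fst (cr_state A b n); p = snd (cr_state A b n); r = - b - A *v s;
          s' = s + (r \<bullet> (A *v r) / ((A *v p) \<bullet> (A *v p))) *\<^sub>R p; r' = - b - A *v s'
      in (s', r' + (r' \<bullet> (A *v r') / (r \<bullet> (A *v r))) *\<^sub>R p))"

definition "cr_iterate A b n = fst (cr_state A b n)"
definition "cr_direction A b n = snd (cr_state A b n)"
definition "cr_residual A b n = - b - A *v cr_iterate A b n"

definition "cr_step_length A b n =
  cr_residual A b n \<bullet> (A *v cr_residual A b n) /
  ((A *v cr_direction A b n) \<bullet> (A *v cr_direction A b n))"

lemma cr_0 [simp]: "cr_iterate A b 0 = 0" "cr_direction A b 0 = - b" "cr_residual A b 0 = - b"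
  by (simp_all add: cr_iterate_def cr_direction_def cr_residual_def)

lemma cr_iterate_Suc:
  "cr_iterate A b (Suc n) = cr_iterate A b n + cr_step_length A b n *\<^sub>R cr_direction A b n"
  by (simp add: cr_iterate_def cr_direction_def cr_residual_def cr_step_length_def Let_def)

lemma cr_direction_Suc:
  "cr_direction A b (Suc n) = cr_residual A b (Suc n) +
     (cr_residual A b (Suc n) \<bullet> (A *v cr_residual A b (Suc n)) /
      (cr_residual A b n \<bullet> (A *v cr_residual A b n))) *\<^sub>R cr_direction A b n"
  by (simp add: cr_iterate_def cr_direction_def cr_residual_def Let_def)

lemma cr_residual_Suc:
  "cr_residual A b (Suc n) = cr_residual A b n - cr_step_length A b n *\<^sub>R (A *v cr_direction A b n)"
  by (simp add: cr_residual_def cr_iterate_Suc algebra_simps matrix_vector_right_distrib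
      matrix_vector_mult_scaleR)

text \<open>
  Vanishing residuals are allowed, so that the condition says exactly that the NPC test has not
  fired, also after the recursion has become stationary.
\<close>

definition cr_no_npc :: "real^'d^'d \<Rightarrow> real^'d \<Rightarrow> nat \<Rightarrow> bool" where
  "cr_no_npc A b n \<longleftrightarrow>
     (\<forall>j<n. cr_residual A b j = 0 \<or> cr_residual A b j \<bullet> (A *v cr_residual A b j) > 0)"

text \<open>
  One induction proves everything about the recursion. Besides the stated properties it carries
  that \<open>A p\<^sub>n\<close> is orthogonal to \<open>A K\<^sub>n\<close> and that \<open>p\<^sub>n - r\<^sub>n\<close> lies in \<open>K\<^sub>n\<close>, where \<open>K\<^sub>n\<close> is the Krylov
  space. Since \<open>r\<^sub>n\<close> spans \<open>K\<^sub>n\<^sub>+\<^sub>1\<close> over \<open>K\<^sub>n\<close> and is orthogonal to \<open>A K\<^sub>n\<close>, the quadratic form of \<open>A\<close> splits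
  along \<open>r\<^sub>n\<close> and \<open>K\<^sub>n\<close>, which makes it positive definite on \<open>K\<^sub>n\<^sub>+\<^sub>1\<close> as long as the tests
  \<open>r\<^sub>n \<bullet> A r\<^sub>n\<close> are positive.
\<close>

lemma cr_invariants:
  fixes A :: "real^'d^'d"
  assumes sym: "\<And>x y. (A *v x) \<bullet> y = x \<bullet> (A *v y)"
    and "cr_no_npc A b n"
  shows cr_iterate_in_krylov: "cr_iterate A b n \<in> krylov A b n"
    and cr_residual_orthogonal: "\<And>v. v \<in> krylov A b n \<Longrightarrow> cr_residual A b n \<bullet> (A *v v) = 0"
    and krylov_Suc_subset_cr: "krylov A b (Suc n) \<subseteq> span (insert (cr_residual A b n) (krylov A b n))"
    and krylov_positive_definite: "\<And>v. v \<in> krylov A b n \<Longrightarrow> v \<noteq> 0 \<Longrightarrow> v \<bullet> (A *v v) > 0"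
proof -
  have "cr_iterate A b n \<in> krylov A b n \<and>
    (\<forall>v\<in>krylov A b n. cr_residual A b n \<bullet> (A *v v) = 0) \<and>
    (\<forall>v\<in>krylov A b n. (A *v cr_direction A b n) \<bullet> (A *v v) = 0) \<and>
    cr_direction A b n - cr_residual A b n \<in> krylov A b n \<and>
    krylov A b (Suc n) \<subseteq> span (insert (cr_residual A b n) (krylov A b n)) \<and>
    (\<forall>v\<in>krylov A b n. v \<noteq> 0 \<longrightarrow> v \<bullet> (A *v v) > 0)"
    using assms(2)
  proof (induction n)
    case 0
    have "krylov A b (Suc 0) \<subseteq> span {- b, 0}"
    proof -
      have "krylov A b (Suc 0) = span {b}"
        by (simp add: krylov_Suc insert_commute[of b] span_insert_0)
      moreover have "b \<in> span {- b, 0}"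
        by (metis add.inverse_inverse insertI1 span_base span_neg)
      ultimately show ?thesis by (metis empty_subsetI insert_subset span_minimal subspace_span)
    qed
    then show ?case by simp
  next
    case (Suc n)
    have nn: "cr_no_npc A b n" using Suc.prems by (simp add: cr_no_npc_def)
    define s p r where "s = cr_iterate A b n" and "p = cr_direction A b n"
      and "r = cr_residual A b n"
    define s' p' r' where "s' = cr_iterate A b (Suc n)" and "p' = cr_direction A b (Suc n)"
      and "r' = cr_residual A b (Suc n)"
    let ?K = "krylov A b n" and ?K' = "krylov A b (Suc n)"
    note IH = Suc.IH[OF nn, folded s_def p_def r_def]
    have sK: "s \<in> ?K" using IH by (rule conjunct1)
    have rAK: "r \<bullet> (A *v v) = 0" if "v \<in> ?K" for v
      using IH[THEN conjunct2, THEN conjunct1] that by (rule bspec)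
    have ApAK: "(A *v p) \<bullet> (A *v v) = 0" if "v \<in> ?K" for v
      using IH[THEN conjunct2, THEN conjunct2, THEN conjunct1] that by (rule bspec)
    note IH' = IH[THEN conjunct2, THEN conjunct2, THEN conjunct2]
    have pr: "p - r \<in> ?K" using IH' by (rule conjunct1)
    have kryK: "?K' \<subseteq> span (insert r ?K)" using IH'[THEN conjunct2] by (rule conjunct1)
    have pdK: "\<forall>v\<in>?K. v \<noteq> 0 \<longrightarrow> v \<bullet> (A *v v) > 0" using IH'[THEN conjunct2] by (rule conjunct2)
    note sub = subspace_krylov[of A b n] and sub' = subspace_krylov[of A b "Suc n"]
    have KK': "?K \<subseteq> ?K'" by (simp add: krylov_mono)
    define a where "a = cr_step_length A b n"
    define be where "be = r' \<bullet> (A *v r') / (r \<bullet> (A *v r))"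
    have s': "s' = s + a *\<^sub>R p"
      by (simp add: s'_def s_def p_def a_def cr_iterate_Suc)
    have r': "r' = r - a *\<^sub>R (A *v p)"
      by (simp add: r'_def r_def p_def a_def cr_residual_Suc)
    have p': "p' = r' + be *\<^sub>R p"
      by (simp add: p'_def r'_def p_def be_def r_def cr_direction_Suc)
    have a: "a = r \<bullet> (A *v r) / ((A *v p) \<bullet> (A *v p))"
      by (simp add: a_def cr_step_length_def r_def p_def)
    have rK': "r \<in> ?K'"
      unfolding r_def cr_residual_def
      by (intro subspace_diff sub' subspace_neg start_in_krylov)
        (use matrix_image_krylov[OF sK] in \<open>simp add: s_def\<close>)
    have pK': "p \<in> ?K'"
      using pr KK' rK' subspace_add[OF sub', of "p - r" r] by auto
    from Suc.prems have "r = 0 \<or> r \<bullet> (A *v r) > 0"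
      by (simp add: cr_no_npc_def r_def)
    then consider (zero) "r = 0" | (pos) "r \<bullet> (A *v r) > 0" by blast
    then show ?case
    proof cases
      (* a zero residual: the iterate solves the system and the Krylov space is exhausted *)
      case zero
      have K'K: "?K' = ?K"
      proof
        have "span (insert 0 ?K) = ?K"
          using sub by (simp only: span_insert_0 span_eq_iff)
        then show "?K' \<subseteq> ?K" using kryK by (simp only: zero)
      qed (fact KK')
      have K''K: "krylov A b (Suc (Suc n)) = ?K"
        using krylov_stationary[of A b n "Suc (Suc n)"] K'K by simp
      have "a = 0" by (simp add: a zero)
      then have "s' = s" "r' = 0" by (simp_all add: s' r' zero)
      moreover have "be = 0" by (simp add: be_def zero)
      ultimately have eqs: "s' = s" "r' = 0" "p' = 0" by (simp_all add: p')
      have "?K \<subseteq> span (insert 0 ?K)" by (rule subset_trans[OF subset_insertI span_superset])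
      with sK pdK subspace_0[OF sub] show ?thesis
        unfolding s'_def[symmetric] p'_def[symmetric] r'_def[symmetric] eqs K''K K'K by simp
    next
      case pos
      have mem: "\<exists>c w. w \<in> ?K \<and> v = c *\<^sub>R r + w" if "v \<in> ?K'" for v
        using mem_span_insert_subspace[OF sub subsetD[OF kryK that]] by metis
      have memp: "\<exists>c w. w \<in> ?K \<and> v = c *\<^sub>R p + w" if v: "v \<in> ?K'" for v
      proof -
        obtain c w where cw: "w \<in> ?K" "v = c *\<^sub>R r + w" using mem[OF v] by blast
        have "v = c *\<^sub>R p + (w - c *\<^sub>R (p - r))" by (simp add: cw algebra_simps)
        moreover have "w - c *\<^sub>R (p - r) \<in> ?K"
          by (intro subspace_diff sub subspace_scale cw pr)
        ultimately show ?thesis by blast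
      qed
      have rAp: "r \<bullet> (A *v p) = r \<bullet> (A *v r)"
      proof -
        have "A *v p = A *v r + A *v (p - r)"
          by (simp add: matrix_vector_mult_diff_distrib)
        then show ?thesis using rAK[OF pr] by (simp add: inner_right_distrib)
      qed
      have Ap0: "A *v p \<noteq> 0" using pos rAp by auto
      then have ApAp: "(A *v p) \<bullet> (A *v p) > 0" by simp
      have a0: "a > 0" using a pos ApAp by simp
      have aApAp: "a * ((A *v p) \<bullet> (A *v p)) = r \<bullet> (A *v r)" using a Ap0 by simp
      have sK': "s' \<in> ?K'"
        unfolding s' using sK KK' pK' by (intro subspace_add subspace_scale sub') auto
      have orth: "r' \<bullet> (A *v v) = 0" if v: "v \<in> ?K'" for v
      proof -
        obtain c w where cw: "w \<in> ?K" "v = c *\<^sub>R p + w" using memp[OF v] by blast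
        have "r' \<bullet> (A *v v) = c * (r' \<bullet> (A *v p)) + r' \<bullet> (A *v w)"
          by (simp add: cw matrix_vector_right_distrib matrix_vector_mult_scaleR inner_right_distrib)
        moreover have "r' \<bullet> (A *v w) = 0"
          using rAK[OF cw(1)] ApAK[OF cw(1)] by (simp add: r' inner_diff_left)
        moreover have "r' \<bullet> (A *v p) = 0"
          using aApAp rAp by (simp add: r' inner_diff_left)
        ultimately show ?thesis by simp
      qed
      (* the image of the direction is a difference of residuals, so one further application of A
         is again controlled by the orthogonality of the new residual *)
      have Ap: "A *v p = (1 / a) *\<^sub>R (r - r')" using a0 by (simp add: r')
      have r'Ap: "r' \<bullet> (A *v (A *v p)) = - (r' \<bullet> (A *v r')) / a"
        using orth[OF rK'] by (simp add: Ap matrix_vector_mult_scaleR inner_diff_right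
            matrix_vector_mult_diff_distrib)
      have conj: "(A *v p') \<bullet> (A *v v) = 0" if v: "v \<in> ?K'" for v
      proof -
        obtain c w where cw: "w \<in> ?K" "v = c *\<^sub>R p + w" using memp[OF v] by blast
        have exp: "(A *v p') \<bullet> (A *v y) = r' \<bullet> (A *v (A *v y)) + be * ((A *v p) \<bullet> (A *v y))" for y
          by (simp add: p' matrix_vector_right_distrib matrix_vector_mult_scaleR inner_left_distrib sym)
        have "(A *v p') \<bullet> (A *v w) = 0"
          using exp[of w] orth[OF matrix_image_krylov[OF cw(1)]] ApAK[OF cw(1)] by simp
        moreover have "(A *v p') \<bullet> (A *v p) = 0"
        proof -
          have "be * ((A *v p) \<bullet> (A *v p)) = r' \<bullet> (A *v r') / a"
            using aApAp pos a0 unfolding be_def by (simp add: field_simps)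
          then show ?thesis using exp[of p] r'Ap by simp
        qed
        ultimately show ?thesis
          by (simp add: cw matrix_vector_right_distrib matrix_vector_mult_scaleR inner_right_distrib)
      qed
      have dir: "p' - r' \<in> ?K'" using pK' by (simp add: p' subspace_scale sub')
      have kry: "krylov A b (Suc (Suc n)) \<subseteq> span (insert r' ?K')"
      proof -
        let ?T = "span (insert r' ?K')"
        have K'T: "?K' \<subseteq> ?T" by (meson insert_subset span_superset)
        have AT: "A *v v \<in> ?T" if v: "v \<in> ?K'" for v
        proof -
          obtain c w where cw: "w \<in> ?K" "v = c *\<^sub>R p + w" using memp[OF v] by blast
          have "A *v w \<in> ?T" using matrix_image_krylov[OF cw(1)] K'T by blast
          moreover have "A *v p \<in> ?T"
            unfolding Ap using rK' K'T by (intro span_scale span_diff) (auto intro: span_base)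
          ultimately show ?thesis
            by (simp add: cw matrix_vector_right_distrib matrix_vector_mult_scaleR span_add span_scale)
        qed
        have "((\<lambda>v. A *v v) ^^ n) b \<in> ?K'" by (simp add: krylov_Suc span_base)
        from AT[OF this] have "((\<lambda>v. A *v v) ^^ Suc n) b \<in> ?T" by simp
        then show ?thesis
          unfolding krylov_Suc[of A b "Suc n"] using K'T by (intro span_minimal) auto
      qed
      have pd: "v \<bullet> (A *v v) > 0" if v: "v \<in> ?K'" "v \<noteq> 0" for v
      proof -
        obtain c w where cw: "w \<in> ?K" "v = c *\<^sub>R r + w" using mem[OF v(1)] by blast
        have "w \<bullet> (A *v r) = 0" using rAK[OF cw(1)] sym[of w r] by (simp add: inner_commute)
        then have eq: "v \<bullet> (A *v v) = c\<^sup>2 * (r \<bullet> (A *v r)) + w \<bullet> (A *v w)"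
          using rAK[OF cw(1)]
          by (simp add: cw matrix_vector_right_distrib matrix_vector_mult_scaleR inner_simps power2_eq_square)
        have w: "w \<bullet> (A *v w) > 0" if "w \<noteq> 0" using pdK cw(1) that by blast
        show ?thesis
        proof (cases "c = 0")
          case True
          then show ?thesis using v cw w eq by simp
        next
          case False
          then have "c\<^sup>2 * (r \<bullet> (A *v r)) > 0" using pos by simp
          moreover have "w \<bullet> (A *v w) \<ge> 0" using w by (cases "w = 0") auto
          ultimately show ?thesis using eq by simp
        qed
      qed
      from sK' orth conj dir kry pd show ?thesis
        unfolding s'_def r'_def p'_def by blast
    qed
  qed
  then show "cr_iterate A b n \<in> krylov A b n"
    "\<And>v. v \<in> krylov A b n \<Longrightarrow> cr_residual A b n \<bullet> (A *v v) = 0"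
    "krylov A b (Suc n) \<subseteq> span (insert (cr_residual A b n) (krylov A b n))"
    "\<And>v. v \<in> krylov A b n \<Longrightarrow> v \<noteq> 0 \<Longrightarrow> v \<bullet> (A *v v) > 0"
    by blast+
qed

text \<open>
  The two residuals differ by \<open>A\<close> applied to an element of the \<open>m\<close>-th Krylov space, and the \<open>m\<close>-th
  residual is orthogonal to such vectors. For \<open>j = 0\<close> this is \<open>b \<bullet> r\<^sub>m = - (norm r\<^sub>m)\<^sup>2\<close>.
\<close>

lemma cr_residual_inner_residual:
  fixes A :: "real^'d^'d"
  assumes sym: "\<And>x y. (A *v x) \<bullet> y = x \<bullet> (A *v y)"
    and "cr_no_npc A b m" "j \<le> m"
  shows "cr_residual A b j \<bullet> cr_residual A b m = (norm (cr_residual A b m))\<^sup>2"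
proof -
  have "cr_no_npc A b j" using assms by (auto simp: cr_no_npc_def)
  then have "cr_iterate A b j \<in> krylov A b m"
    using cr_iterate_in_krylov[OF sym] krylov_mono[OF \<open>j \<le> m\<close>] by blast
  then have "cr_iterate A b m - cr_iterate A b j \<in> krylov A b m"
    by (intro subspace_diff subspace_krylov cr_iterate_in_krylov[OF sym] assms)
  then have "cr_residual A b m \<bullet> (A *v (cr_iterate A b m - cr_iterate A b j)) = 0"
    using cr_residual_orthogonal[OF sym assms(2)] by blast
  moreover have "cr_residual A b j
      = cr_residual A b m + A *v (cr_iterate A b m - cr_iterate A b j)"
    by (simp add: cr_residual_def matrix_vector_mult_diff_distrib)
  ultimately show ?thesis
    by (simp add: inner_add_left inner_commute[of "A *v _"] power2_norm_eq_inner)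
qed

lemma cr_step_length_nonneg:
  assumes "cr_no_npc A b m" "j < m"
  shows "cr_step_length A b j \<ge> 0"
proof -
  have "cr_residual A b j \<bullet> (A *v cr_residual A b j) \<ge> 0"
    using assms by (auto simp: cr_no_npc_def)
  then show ?thesis by (simp add: cr_step_length_def)
qed

text \<open>
  A direction is a combination of earlier residuals, and before nonpositive curvature shows up
  all its coefficients are nonnegative.
\<close>

lemma cr_direction_inner_residual_nonneg:
  fixes A :: "real^'d^'d"
  assumes sym: "\<And>x y. (A *v x) \<bullet> y = x \<bullet> (A *v y)"
    and no: "cr_no_npc A b m" and "j < m"
  shows "cr_direction A b j \<bullet> cr_residual A b m \<ge> 0"
  using \<open>j < m\<close>
proof (induction j)
  case 0
  then show ?case using cr_residual_inner_residual[OF sym no, of 0] by simp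
next
  case (Suc j)
  have nn: "cr_residual A b i \<bullet> (A *v cr_residual A b i) \<ge> 0" if "i < m" for i
    using that no by (auto simp: cr_no_npc_def)
  show ?case
    using Suc nn[of j] nn[of "Suc j"] cr_residual_inner_residual[OF sym no, of "Suc j"]
    by (simp add: cr_direction_Suc inner_left_distrib)
qed

text \<open>
  As \<open>r\<^sub>m = - b - A s\<^sub>m\<close>, this says \<open>b \<bullet> s\<^sub>m \<le> - (s\<^sub>m \<bullet> A s\<^sub>m)\<close>: the iterate is a descent direction
  whenever \<open>A\<close> is positive definite on the Krylov space.
\<close>

lemma cr_iterate_inner_residual_nonneg:
  fixes A :: "real^'d^'d"
  assumes sym: "\<And>x y. (A *v x) \<bullet> y = x \<bullet> (A *v y)"
    and no: "cr_no_npc A b m"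
  shows "cr_iterate A b m \<bullet> cr_residual A b m \<ge> 0"
proof -
  have "cr_iterate A b j \<bullet> cr_residual A b m \<ge> 0" if "j \<le> m" for j
    using that
  proof (induction j)
    case (Suc j)
    then show ?case
      using cr_direction_inner_residual_nonneg[OF sym no, of j] cr_step_length_nonneg[OF no, of j]
      by (simp add: cr_iterate_Suc inner_left_distrib)
  qed simp
  then show ?thesis by simp
qed

section \<open>MINRES as a conjugate residual method\<close>

text \<open>
  The residual is orthogonal to \<open>A K\<close>, so Pythagoras makes the conjugate residual iterate a
  minimizer over the Krylov space \<open>K\<close>; it is the only one because \<open>A\<close>, being positive definite there,
  is injective on \<open>K\<close>.
\<close>

lemma minres_minimizer_cr_iff:
  fixes A :: "real^'d^'d"
  assumes sym: "\<And>x y. (A *v x) \<bullet> y = x \<bullet> (A *v y)"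
    and no: "cr_no_npc A b n"
  shows "minres_minimizer A b n s \<longleftrightarrow> s = cr_iterate A b n"
proof -
  let ?s = "cr_iterate A b n" and ?K = "krylov A b n"
  have sK: "?s \<in> ?K" by (rule cr_iterate_in_krylov[OF sym no])
  have pyth: "(norm (A *v y + b))\<^sup>2 = (norm (A *v (y - ?s)))\<^sup>2 + (norm (A *v ?s + b))\<^sup>2"
    if "y \<in> ?K" for y
  proof -
    have "cr_residual A b n \<bullet> (A *v (y - ?s)) = 0"
      by (intro cr_residual_orthogonal[OF sym no] subspace_diff subspace_krylov sK that)
    then have 1: "(A *v ?s + b) \<bullet> (A *v (y - ?s)) = 0"
      by (simp add: cr_residual_def inner_diff_left inner_add_left)
    have "A *v y + b = A *v (y - ?s) + (A *v ?s + b)"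
      by (simp add: matrix_vector_mult_diff_distrib)
    then show ?thesis
      using 1 by (simp add: power2_norm_eq_inner inner_add_left inner_add_right inner_commute)
  qed
  show ?thesis
  proof
    assume "minres_minimizer A b n s"
    then have s: "s \<in> ?K" "\<not> (norm (A *v ?s + b))\<^sup>2 < (norm (A *v s + b))\<^sup>2"
      using sK by (auto simp: minres_minimizer_def is_arg_min_def)
    then have "A *v (s - ?s) = 0" using pyth[OF s(1)] by simp
    moreover have "s - ?s \<in> ?K" by (intro subspace_diff subspace_krylov sK s)
    ultimately show "s = ?s" using krylov_positive_definite[OF sym no, of "s - ?s"] by fastforce
  next
    assume "s = ?s"
    moreover have "(norm (A *v ?s + b))\<^sup>2 \<le> (norm (A *v y + b))\<^sup>2" if "y \<in> ?K" for y
      using pyth[OF that] by simp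
    ultimately show "minres_minimizer A b n s"
      using sK by (auto simp: minres_minimizer_def is_arg_min_def not_less)
  qed
qed

lemma minres_iterate_eq_cr:
  fixes A :: "real^'d^'d"
  assumes sym: "\<And>x y. (A *v x) \<bullet> y = x \<bullet> (A *v y)"
    and no: "cr_no_npc A b n"
  shows "minres_iterate A b n = cr_iterate A b n"
proof (cases n)
  case (Suc k)
  have "minres_minimizer A b (Suc k) = (\<lambda>s. s = cr_iterate A b (Suc k))"
    using no by (intro ext minres_minimizer_cr_iff[OF sym]) (simp add: Suc)
  then show ?thesis by (simp add: Suc)
qed simp

text \<open>
  The test at iteration \<open>n + 1\<close> inspects the MINRES residual \<open>n\<close>, which is the conjugate residual
  \<open>n\<close> because the earlier tests have not fired.
\<close>

lemma no_npc_imp_cr_no_npc: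
  fixes A :: "real^'d^'d"
  assumes sym: "\<And>x y. (A *v x) \<bullet> y = x \<bullet> (A *v y)"
    and "\<And>i. 1 \<le> i \<Longrightarrow> i \<le> n \<Longrightarrow> \<not> npc_detected A b i"
  shows "cr_no_npc A b n"
  using assms(2)
proof (induction n)
  case 0
  then show ?case by (simp add: cr_no_npc_def)
next
  case (Suc n)
  then have no: "cr_no_npc A b n" by simp
  have "minres_residual A b n = cr_residual A b n"
    by (simp add: minres_residual_def cr_residual_def minres_iterate_eq_cr[OF sym no])
  then show ?case
    using Suc.prems[of "Suc n"] no by (auto simp: cr_no_npc_def npc_detected_def less_Suc_eq)
qed

lemma minres_residual_eq_cr:
  fixes A :: "real^'d^'d"
  assumes sym: "\<And>x y. (A *v x) \<bullet> y = x \<bullet> (A *v y)"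
    and no: "cr_no_npc A b n"
  shows "minres_residual A b n = cr_residual A b n"
  by (simp add: minres_residual_def cr_residual_def minres_iterate_eq_cr[OF sym no])

lemma minres_returns_NPC:
  fixes A :: "real^'d^'d"
  assumes sym: "\<And>x y. (A *v x) \<bullet> y = x \<bullet> (A *v y)"
    and "minres_returns A b \<eta> NPC d"
  obtains n where "cr_no_npc A b n" "d = cr_residual A b n" "d \<noteq> 0" "d \<bullet> (A *v d) \<le> 0"
proof -
  obtain t where t: "t \<ge> 1" "\<And>j. 1 \<le> j \<Longrightarrow> j < t \<Longrightarrow> \<not> npc_detected A b j"
    "npc_detected A b t" "d = minres_residual A b (t - 1)"
    using assms(2) by (auto simp: minres_returns_def)
  have no: "cr_no_npc A b (t - 1)" using t by (intro no_npc_imp_cr_no_npc[OF sym]) auto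
  show ?thesis
    by (rule that[OF no]) (use t minres_residual_eq_cr[OF sym no] in \<open>simp_all add: npc_detected_def\<close>)
qed

lemma minres_returns_SOL:
  fixes A :: "real^'d^'d"
  assumes sym: "\<And>x y. (A *v x) \<bullet> y = x \<bullet> (A *v y)"
    and "minres_returns A b \<eta> SOL d"
  obtains n where "\<forall>i\<in>{1..Suc n}. \<not> npc_detected A b i"
    "cr_no_npc A b (Suc n)" "d = cr_iterate A b n"
    "norm (A *v cr_residual A b n) \<le> \<eta> * norm (A *v d)"
proof -
  obtain t where t: "t \<ge> 1" "\<And>j. 1 \<le> j \<Longrightarrow> j < t \<Longrightarrow> \<not> npc_detected A b j"
    "\<not> npc_detected A b t" "sol_accepted A b \<eta> t" "d = minres_iterate A b (t - 1)"
    using assms(2) by (simp add: minres_returns_def) blast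
  from t(1) obtain n where n: "t = Suc n" by (cases t) simp_all
  have np: "\<not> npc_detected A b i" if "1 \<le> i" "i \<le> Suc n" for i
    using t(2,3) that by (cases "i = t") (simp_all add: n)
  have no: "cr_no_npc A b (Suc n)" by (rule no_npc_imp_cr_no_npc[OF sym np])
  then have no': "cr_no_npc A b n" by (auto simp: cr_no_npc_def)
  show ?thesis
    by (rule that[OF _ no])
      (use t n np minres_residual_eq_cr[OF sym no'] minres_iterate_eq_cr[OF sym no']
       in \<open>simp_all add: sol_accepted_def\<close>)
qed

section \<open>The grade\<close>

lemma dim_krylov_Suc_le: "dim (krylov A b (Suc t)) \<le> Suc (dim (krylov A b t))"
  unfolding krylov_Suc by (simp add: dim_insert)

text \<open>
  A strictly increasing chain of subspaces would exceed the dimension of the space.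
\<close>

lemma krylov_becomes_stationary: "\<exists>t. krylov A b (Suc t) \<subseteq> krylov A b t"
proof (rule ccontr)
  assume "\<not> ?thesis"
  then have strict: "krylov A b t \<subset> krylov A b (Suc t)" for t
    using krylov_mono[of t "Suc t" A b] by auto
  have "t \<le> dim (krylov A b t)" for t
  proof (induction t)
    case (Suc t)
    have "dim (krylov A b t) < dim (krylov A b (Suc t))"
      using strict[of t] by (intro dim_psubset) (simp add: subspace_krylov span_eq_iff[THEN iffD2])
    then show ?case using Suc by linarith
  qed simp
  from this[of "Suc DIM(real^'a)"] show False
    using dim_subset_UNIV[of "krylov A b (Suc DIM(real^'a))"] by simp
qed

text \<open>
  The definite description in the definition of the grade denotes the first index at which the
  Krylov spaces stop growing: up to there every step adds exactly one dimension.
\<close>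

lemma grade_eq_and_stationary:
  fixes A :: "real^'d^'d" and b :: "real^'d"
  defines "m \<equiv> LEAST t. krylov A b (Suc t) \<subseteq> krylov A b t"
  shows "grade A b = m" and "krylov A b (Suc (grade A b)) \<subseteq> krylov A b (grade A b)"
proof -
  have st: "krylov A b (Suc m) \<subseteq> krylov A b m"
    unfolding m_def by (rule LeastI_ex[OF krylov_becomes_stationary])
  have d: "dim (krylov A b t) = t" if "t \<le> m" for t
    using that
  proof (induction t)
    case (Suc t)
    then have "\<not> krylov A b (Suc t) \<subseteq> krylov A b t"
      unfolding m_def by (intro not_less_Least) simp
    then have "krylov A b t \<subset> krylov A b (Suc t)"
      using krylov_mono[of t "Suc t" A b] by auto
    then have "dim (krylov A b t) < dim (krylov A b (Suc t))"
      by (intro dim_psubset) (simp add: subspace_krylov span_eq_iff[THEN iffD2])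
    then show ?case using Suc dim_krylov_Suc_le[of A b t] by simp
  qed simp
  have all: "dim (krylov A b t) = min t m" for t
  proof (cases "t \<le> m")
    case False
    then show ?thesis using krylov_stationary[OF st, of t] d[of m] by simp
  qed (simp add: d)
  show "grade A b = m"
    unfolding grade_def
  proof (rule the_equality)
    fix k assume k: "\<forall>t\<ge>1. dim (krylov A b t) = min t k"
    then have "min (Suc (max k m)) k = min (Suc (max k m)) m" using all by (metis le_add1 plus_1_eq_Suc)
    then show "k = m" by simp
  qed (simp add: all)
  with st show "krylov A b (Suc (grade A b)) \<subseteq> krylov A b (grade A b)" by simp
qed

text \<open>
  Beyond the grade the Krylov space no longer changes, so the regularity condition extends to all
  indices.
\<close>

lemma krylov_regular_I_all:
  assumes "krylov_regular_I g H \<sigma>"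
    and np: "\<forall>i\<in>{1..t}. \<not> npc_detected (H x) (g x) i"
    and "s \<in> krylov (H x) (g x) t"
  shows "s \<bullet> (H x *v s) \<ge> \<sigma> * (norm s)\<^sup>2"
proof -
  let ?m = "min t (grade (H x) (g x))"
  have "s \<in> krylov (H x) (g x) ?m"
    using assms(3) krylov_stationary[OF grade_eq_and_stationary(2), of "H x" "g x" t]
    by (cases "t \<le> grade (H x) (g x)") (auto simp: min_def)
  moreover have "\<forall>i\<in>{1..?m}. \<not> npc_detected (H x) (g x) i" using np by auto
  ultimately show ?thesis using assms(1) unfolding krylov_regular_I_def
    by (meson min.cobounded2)
qed

section \<open>Eigenvectors of symmetric matrices\<close>

text \<open>
  A minimizer of the Rayleigh quotient on the unit sphere of an invariant subspace is an
  eigenvector. Both uses are covered: the whole space gives the smallest eigenvalue, and the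
  orthogonal complement of all eigenvectors must be zero.
\<close>

lemma rayleigh_minimum_eigenvector:
  fixes A :: "real^'d^'d"
  assumes sym: "\<And>x y. (A *v x) \<bullet> y = x \<bullet> (A *v y)"
    and S: "subspace S" "\<And>v. v \<in> S \<Longrightarrow> A *v v \<in> S" and "S \<noteq> {0}"
  obtains v where "v \<in> S" "norm v = 1" "A *v v = (v \<bullet> (A *v v)) *\<^sub>R v"
    "\<forall>w\<in>S. w \<bullet> (A *v w) \<ge> (v \<bullet> (A *v v)) * (norm w)\<^sup>2"
proof -
  let ?q = "\<lambda>v. v \<bullet> (A *v v)"
  have comp: "compact (S \<inter> sphere 0 1)"
    by (simp add: closed_Int_compact closed_subspace S(1))
  obtain u where u: "u \<in> S" "u \<noteq> 0" using \<open>S \<noteq> {0}\<close> S(1) subspace_0 by blast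
  have "u /\<^sub>R norm u \<in> S \<inter> sphere 0 1" using u S(1) by (simp add: subspace_scale)
  then have ne: "S \<inter> sphere 0 1 \<noteq> {}" by blast
  have "continuous_on (S \<inter> sphere 0 1) ?q"
    by (intro continuous_intros linear_continuous_on matrix_vector_mul_bounded_linear)
  from continuous_attains_inf[OF comp ne this]
  obtain v where v: "v \<in> S" "norm v = 1" and
    min: "\<And>w. w \<in> S \<Longrightarrow> norm w = 1 \<Longrightarrow> ?q v \<le> ?q w" by auto
  define m where "m = ?q v"
  have low: "?q w \<ge> m * (norm w)\<^sup>2" if "w \<in> S" for w
  proof (cases "w = 0")
    case False
    have "m \<le> ?q (w /\<^sub>R norm w)"
      unfolding m_def using that False S(1) by (intro min) (auto simp: subspace_scale)
    also have "\<dots> = ?q w / (norm w)\<^sup>2"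
      using False by (simp add: matrix_vector_mult_scaleR power2_eq_square divide_inverse mult.commute)
    finally show ?thesis using False by (simp add: pos_le_divide_eq)
  qed simp
  define z where "z = A *v v - m *\<^sub>R v"
  have zS: "z \<in> S" unfolding z_def by (intro subspace_diff subspace_scale S v)
  have vv: "v \<bullet> v = 1" using v(2) by (simp add: norm_eq_1)
  (* perturbing v by t z changes the quotient to first order by 2 t |z|^2 *)
  have quad: "0 \<le> 2 * t * (z \<bullet> z) + t\<^sup>2 * (?q z - m * (z \<bullet> z))" for t
  proof -
    have "v + t *\<^sub>R z \<in> S" by (intro subspace_add subspace_scale S v zS)
    from low[OF this] have "m * ((v + t *\<^sub>R z) \<bullet> (v + t *\<^sub>R z)) \<le> ?q (v + t *\<^sub>R z)"
      by (simp add: power2_norm_eq_inner)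
    moreover have "v \<bullet> (A *v z) = z \<bullet> (A *v v)" using sym[of z v] sym[of v z] by (simp add: inner_commute)
    moreover have "z \<bullet> (A *v v) = z \<bullet> z + m * (z \<bullet> v)" 
    proof -
      have "A *v v = z + m *\<^sub>R v" by (simp add: z_def)
      then show ?thesis by (simp add: inner_add_right)
    qed
    ultimately show ?thesis
      by (simp add: matrix_vector_right_distrib matrix_vector_mult_scaleR inner_simps vv
          m_def[symmetric] inner_commute[of v z] power2_eq_square algebra_simps)
  qed
  have "z \<bullet> z = 0"
  proof (rule ccontr)
    assume "z \<bullet> z \<noteq> 0"
    then have zz: "z \<bullet> z > 0" by simp
    define c where "c = ?q z - m * (z \<bullet> z)"
    have c0: "c \<ge> 0" using low[OF zS] by (simp add: c_def power2_norm_eq_inner)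
    (* a step against the first-order term, short enough to dominate the second-order term c *)
    define t where "t = - (z \<bullet> z) / (c + 1)"
    have t0: "t < 0" using zz c0 by (simp add: t_def)
    have "t * (c + 1) = - (z \<bullet> z)" using c0 by (simp add: t_def)
    then have "t * c \<ge> - (z \<bullet> z)" using t0 by (simp add: algebra_simps)
    then have "2 * (z \<bullet> z) + t * c > 0" using zz by linarith
    then have "t * (2 * (z \<bullet> z) + t * c) < 0" using t0 by (simp add: mult_neg_pos)
    then show False using quad[of t] by (simp add: c_def power2_eq_square algebra_simps)
  qed
  then have "A *v v = m *\<^sub>R v" by (simp add: z_def)
  then show ?thesis
    by (intro that[of v] v ballI) (use low in \<open>simp_all only: m_def\<close>)
qed

lemma eigenvectors_orthogonal:
  fixes A :: "real^'d^'d"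
  assumes sym: "\<And>x y. (A *v x) \<bullet> y = x \<bullet> (A *v y)"
    and "A *v v = \<mu> *\<^sub>R v" "A *v w = \<nu> *\<^sub>R w" "\<mu> \<noteq> \<nu>"
  shows "v \<bullet> w = 0"
  using sym[of v w] assms(2-4) by simp

lemma finite_eigenvalues:
  fixes A :: "real^'d^'d"
  assumes sym: "\<And>x y. (A *v x) \<bullet> y = x \<bullet> (A *v y)"
  shows "finite (eigenvalues A)"
proof -
  have "\<forall>\<mu>\<in>eigenvalues A. \<exists>v. v \<noteq> 0 \<and> A *v v = \<mu> *\<^sub>R v" by (simp add: eigenvalues_def)
  from bchoice[OF this]
  obtain e where e: "\<And>\<mu>. \<mu> \<in> eigenvalues A \<Longrightarrow> e \<mu> \<noteq> 0 \<and> A *v e \<mu> = \<mu> *\<^sub>R e \<mu>" by blast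
  have orth: "e \<mu> \<bullet> e \<nu> = 0" if "\<mu> \<in> eigenvalues A" "\<nu> \<in> eigenvalues A" "\<mu> \<noteq> \<nu>" for \<mu> \<nu>
    using eigenvectors_orthogonal[OF sym] e that by blast
  have "inj_on e (eigenvalues A)"
  proof (rule inj_onI, rule ccontr)
    fix \<mu> \<nu> assume "\<mu> \<in> eigenvalues A" "\<nu> \<in> eigenvalues A" "e \<mu> = e \<nu>" "\<mu> \<noteq> \<nu>"
    then show False using orth[of \<mu> \<nu>] e[of \<nu>] by simp
  qed
  moreover have "finite (e ` eigenvalues A)"
    by (intro pairwise_orthogonal_imp_finite)
      (auto simp: pairwise_def orthogonal_def intro: orth)
  ultimately show ?thesis using finite_imageD by blast
qed

lemma lambda_min_ge:
  fixes A :: "real^'d^'d"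
  assumes sym: "\<And>x y. (A *v x) \<bullet> y = x \<bullet> (A *v y)"
    and "\<And>v. v \<bullet> (A *v v) \<ge> c * (norm v)\<^sup>2"
  shows "lambda_min A \<ge> c"
proof -
  have "(UNIV :: (real^'d) set) \<noteq> {0}"
    by (metis UNIV_I axis_eq_0_iff singletonD zero_neq_one)
  then obtain v where v: "norm v = 1" "A *v v = (v \<bullet> (A *v v)) *\<^sub>R v"
    using rayleigh_minimum_eigenvector[OF sym subspace_UNIV UNIV_I] by blast
  then have "v \<noteq> 0" by auto
  then have "eigenvalues A \<noteq> {}" using v unfolding eigenvalues_def by blast
  moreover have "c \<le> \<mu>" if \<mu>: "\<mu> \<in> eigenvalues A" for \<mu>
  proof -
    obtain w where w: "w \<noteq> 0" "A *v w = \<mu> *\<^sub>R w" using \<mu> unfolding eigenvalues_def by blast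
    then have "c * (norm w)\<^sup>2 \<le> \<mu> * (norm w)\<^sup>2"
      using assms(2)[of w] by (simp add: power2_norm_eq_inner)
    then show ?thesis using w(1) by simp
  qed
  ultimately show ?thesis by (simp add: lambda_min_def finite_eigenvalues[OF sym])
qed

lemma mat_mult_vec: "mat c *v v = c *\<^sub>R (v :: real^'d)"
  by (simp add: vec_eq_iff matrix_vector_mult_def mat_def if_distrib[of "\<lambda>x. x * _"] cong: if_cong)

lemma eigenspace_iff: "v \<in> eigenspace A \<mu> \<longleftrightarrow> A *v v = \<mu> *\<^sub>R v"
  by (simp add: eigenspace_def matrix_vector_mult_diff_rdistrib mat_mult_vec)

text \<open>
  The spectral theorem in the form needed here: the vectors orthogonal to all eigenvectors form
  an invariant subspace, which would contain an eigenvector if it were not zero.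
\<close>

lemma orthogonal_to_eigenvectors_imp_0:
  fixes A :: "real^'d^'d"
  assumes sym: "\<And>x y. (A *v x) \<bullet> y = x \<bullet> (A *v y)"
    and "\<And>\<mu> v. A *v v = \<mu> *\<^sub>R v \<Longrightarrow> z \<bullet> v = 0"
  shows "z = 0"
proof (rule ccontr)
  assume "z \<noteq> 0"
  define E where "E = {v. \<exists>\<mu>. A *v v = \<mu> *\<^sub>R v}"
  define S where "S = {y. \<forall>v\<in>E. y \<bullet> v = 0}"
  have sub: "subspace S" by (auto simp: S_def subspace_def inner_add_left)
  have inv: "A *v y \<in> S" if y: "y \<in> S" for y
    unfolding S_def
  proof (intro CollectI ballI)
    fix v assume v: "v \<in> E"
    then obtain \<mu> where "A *v v = \<mu> *\<^sub>R v" by (auto simp: E_def)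
    then show "(A *v y) \<bullet> v = 0" using sym[of y v] y v by (auto simp: S_def)
  qed
  have "z \<in> S" unfolding S_def E_def using assms(2) by blast
  with \<open>z \<noteq> 0\<close> have "S \<noteq> {0}" by (metis singletonD)
  from rayleigh_minimum_eigenvector[OF sym sub inv this]
  obtain v where "v \<in> S" "norm v = 1" "A *v v = (v \<bullet> (A *v v)) *\<^sub>R v" by metis
  then have "v \<bullet> v = 0" unfolding S_def E_def by blast
  with \<open>norm v = 1\<close> show False by (simp add: norm_eq_1)
qed

section \<open>Relevant eigenvalues\<close>

lemma krylov_subset_invariant:
  assumes "subspace S" "\<And>v. v \<in> S \<Longrightarrow> A *v v \<in> S" "b \<in> S"
  shows "krylov A b t \<subseteq> S"
proof -
  have "((\<lambda>v. A *v v) ^^ i) b \<in> S" for i by (induction i) (use assms in auto)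
  then show ?thesis unfolding krylov_def by (intro span_minimal assms) auto
qed

text \<open>
  The component of \<open>b\<close> outside this span is orthogonal to every eigenvector: to the relevant ones
  by construction, to the others because both \<open>b\<close> and the relevant eigenspaces are.
\<close>

lemma in_span_relevant_eigenspaces:
  fixes A :: "real^'d^'d"
  assumes sym: "\<And>x y. (A *v x) \<bullet> y = x \<bullet> (A *v y)"
  shows "b \<in> span (\<Union>\<mu> \<in> relevant_eigenvalues A b. eigenspace A \<mu>)" (is "b \<in> span ?E")
proof -
  obtain w z where w: "w \<in> span ?E" and z: "\<And>y. y \<in> span ?E \<Longrightarrow> orthogonal z y"
    and b: "b = w + z"
    using orthogonal_subspace_decomp_exists[of ?E b] by blast
  have "z \<bullet> v = 0" if v: "A *v v = \<mu> *\<^sub>R v" for \<mu> v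
  proof (cases "v = 0 \<or> \<mu> \<in> relevant_eigenvalues A b")
    case True
    then show ?thesis
    proof
      assume "\<mu> \<in> relevant_eigenvalues A b"
      then have "v \<in> span ?E" using v by (intro span_base) (auto simp: eigenspace_iff)
      then show ?thesis using z by (simp add: orthogonal_def)
    qed simp
  next
    case False
    then have "\<mu> \<in> eigenvalues A" using v by (auto simp: eigenvalues_def)
    then have bv: "b \<bullet> v = 0"
      using False v by (auto simp: relevant_eigenvalues_def eigenspace_iff)
    have "orthogonal v w"
    proof (rule orthogonal_to_span[OF w])
      fix y assume "y \<in> ?E"
      then obtain \<nu> where "\<nu> \<in> relevant_eigenvalues A b" "A *v y = \<nu> *\<^sub>R y"
        by (auto simp: eigenspace_iff)
      then show "orthogonal v y"
        unfolding orthogonal_def using False v by (intro eigenvectors_orthogonal[OF sym]) auto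
    qed
    then show ?thesis using bv by (simp add: b inner_add_left orthogonal_def inner_commute[of w])
  qed
  then have "z = 0" by (rule orthogonal_to_eigenvectors_imp_0[OF sym])
  then have "w = b" using b by simp
  from w show ?thesis unfolding \<open>w = b\<close> .
qed

lemma spectral_norm_bound: "norm (A *v v) \<le> spectral_norm A * norm v"
  unfolding spectral_norm_def by (rule onorm[OF matrix_vector_mul_bounded_linear])

lemma matrix_mult_padded_basis:
  fixes U :: "real^'d^'d"
  assumes "\<forall>i\<in>J. \<forall>j\<in>J. column i U \<bullet> column j U = (if i = j then 1 else 0)"
    and "\<forall>j. j \<notin> J \<longrightarrow> column j U = 0" and "w \<in> span ((\<lambda>j. column j U) ` J)"
  shows "U *v (transpose U *v w) = w" and "norm (transpose U *v w) = norm w"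
proof -
  have comp: "(transpose U *v y) $ j = column j U \<bullet> y" for y j
    by (simp add: matrix_vector_mult_def transpose_def column_def inner_vec_def)
  have U: "U *v y = (\<Sum>j\<in>UNIV. y $ j *\<^sub>R column j U)" for y
    by (simp add: matrix_mult_sum scalar_mult_eq_scaleR)
  show eq: "U *v (transpose U *v w) = w"
    using assms(3)
  proof (induction rule: span_induct_alt)
    case base
    then show ?case by simp
  next
    case (step c x y)
    then obtain i where i: "i \<in> J" "x = column i U" by auto
    have "U *v (transpose U *v x) = (\<Sum>j\<in>UNIV. (if j = i then 1 else 0) *\<^sub>R column j U)"
      unfolding U comp
    proof (intro sum.cong refl)
      fix j
      show "(column j U \<bullet> x) *\<^sub>R column j U = (if j = i then 1 else 0) *\<^sub>R column j U"
        using assms(1,2) i by (cases "j \<in> J") auto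
    qed
    also have "\<dots> = x" by (simp add: i if_distrib[of "\<lambda>c. c *\<^sub>R _"] cong: if_cong)
    finally have "U *v (transpose U *v x) = x" .
    then show ?case using step by (simp add: matrix_vector_right_distrib matrix_vector_mult_scaleR)
  qed
  have "(norm (transpose U *v w))\<^sup>2 = w \<bullet> (U *v (transpose U *v w))"
    by (metis dot_lmul_matrix inner_commute power2_norm_eq_inner transpose_matrix_vector)
  then have "(norm (transpose U *v w))\<^sup>2 = (norm w)\<^sup>2" by (simp only: eq power2_norm_eq_inner)
  then show "norm (transpose U *v w) = norm w" by simp
qed

text \<open>
  The Krylov spaces lie in the span of the relevant eigenspaces. Splitting off the component in
  the null space leaves a vector in the span of the columns of \<open>U\<close>, an invariant subspace on which
  \<open>A\<close> acts like \<open>transpose U ** A ** U\<close> in an orthonormal basis.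
\<close>

lemma relevant_bound_on_krylov:
  fixes A :: "real^'d^'d"
  assumes sym: "\<And>x y. (A *v x) \<bullet> y = x \<bullet> (A *v y)"
    and basis: "relevant_eigenbasis A b J U" and L: "spectral_norm (transpose U ** A ** U) \<le> L"
    and s: "s \<in> krylov A b t"
  shows "norm (A *v s) \<le> L * norm s"
proof -
  let ?R = "relevant_eigenvalues A b"
  let ?W = "span (\<Union>\<mu>\<in>?R - {0}. eigenspace A \<mu>)"
  let ?E = "span (\<Union>\<mu>\<in>?R. eigenspace A \<mu>)"
  have inv: "A *v v \<in> span (\<Union>\<mu>\<in>T. eigenspace A \<mu>)"
    if "v \<in> span (\<Union>\<mu>\<in>T. eigenspace A \<mu>)" for v T
    using that
  proof (induction rule: span_induct_alt)
    case (step c x y)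
    then obtain \<mu> where "A *v x = \<mu> *\<^sub>R x" by (auto simp: eigenspace_iff)
    then have "A *v x \<in> span (\<Union>\<mu>\<in>T. eigenspace A \<mu>)"
      using step by (simp add: span_scale span_base)
    then show ?case using step by (simp add: matrix_vector_right_distrib matrix_vector_mult_scaleR span_add span_scale)
  qed (simp add: span_zero)
  have "s \<in> ?E"
    using krylov_subset_invariant[of ?E A b t] inv in_span_relevant_eigenspaces[OF sym] s by blast
  then have "\<exists>w k. s = w + k \<and> w \<in> ?W \<and> A *v k = 0"
  proof (induction rule: span_induct_alt)
    case base
    show ?case by (rule exI[of _ 0], rule exI[of _ 0]) (simp add: span_zero)
  next
    case (step c x y)
    then obtain \<mu> w k where \<mu>: "\<mu> \<in> ?R" "x \<in> eigenspace A \<mu>" and wk: "y = w + k" "w \<in> ?W" "A *v k = 0"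
      by blast
    show ?case
    proof (cases "\<mu> = 0")
      case True
      then have "A *v (c *\<^sub>R x + k) = 0" using \<mu> wk
        by (simp add: eigenspace_iff matrix_vector_right_distrib matrix_vector_mult_scaleR)
      then show ?thesis using wk by (intro exI[of _ w] exI[of _ "c *\<^sub>R x + k"]) simp
    next
      case False
      then have "c *\<^sub>R x + w \<in> ?W" using \<mu> wk
        by (intro span_add span_scale) (auto intro: span_base)
      then show ?thesis using wk by (intro exI[of _ "c *\<^sub>R x + w"] exI[of _ k]) simp
    qed
  qed
  then obtain w k where wk: "s = w + k" "w \<in> ?W" "A *v k = 0" by blast
  have "w \<bullet> k = 0"
    using wk(2)
  proof (induction rule: span_induct_alt)
    case (step c x y)
    then obtain \<mu> where "\<mu> \<noteq> 0" "A *v x = \<mu> *\<^sub>R x" by (auto simp: eigenspace_iff)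
    then have "x \<bullet> k = 0" using eigenvectors_orthogonal[OF sym, of x \<mu> k 0] wk(3) by simp
    then show ?case using step by (simp add: inner_add_left)
  qed simp
  then have "(norm s)\<^sup>2 = (norm w)\<^sup>2 + (norm k)\<^sup>2"
    by (simp add: wk power2_norm_eq_inner inner_add_left inner_add_right inner_commute)
  then have ws: "norm w \<le> norm s" by (simp add: power2_le_imp_le)
  have orth: "\<forall>i\<in>J. \<forall>j\<in>J. column i U \<bullet> column j U = (if i = j then 1 else 0)"
    "\<forall>j. j \<notin> J \<longrightarrow> column j U = 0" and W: "?W = span ((\<lambda>j. column j U) ` J)"
    using basis by (auto simp: relevant_eigenbasis_def)
  note w = matrix_mult_padded_basis[OF orth wk(2)[unfolded W]]
  note Aw = matrix_mult_padded_basis[OF orth inv[OF wk(2), unfolded W]]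
  have "A *v s = A *v w" by (simp add: wk matrix_vector_right_distrib)
  then have 1: "norm (A *v s) = norm ((transpose U ** A ** U) *v (transpose U *v w))"
    using Aw(2) w(1) by (simp add: matrix_vector_mul_assoc[symmetric])
  have 2: "\<dots> \<le> spectral_norm (transpose U ** A ** U) * norm w"
    using spectral_norm_bound[of "transpose U ** A ** U" "transpose U *v w"] unfolding w(2) .
  have "spectral_norm (transpose U ** A ** U) \<ge> 0"
    unfolding spectral_norm_def by (rule onorm_pos_le[OF matrix_vector_mul_bounded_linear])
  then have "spectral_norm (transpose U ** A ** U) * norm w \<le> L * norm s"
    using L ws by (intro mult_mono) simp_all
  with 2 show ?thesis unfolding 1 by (rule order_trans)
qed

section \<open>Negative eigenvalues and Krylov spaces\<close>

text \<open>
  The orthogonal projection of an eigenvector onto an invariant subspace is zero or again an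
  eigenvector for the same eigenvalue. If that eigenvalue is negative, the second alternative
  contradicts the nonnegative curvature on the Krylov spaces, so \<open>v\<close> is orthogonal to all of them.
\<close>

lemma krylov_psd_imp_orthogonal:
  fixes A :: "real^'d^'d"
  assumes sym: "\<And>x y. (A *v x) \<bullet> y = x \<bullet> (A *v y)"
    and v: "A *v v = \<mu> *\<^sub>R v" "\<mu> < 0"
    and psd: "\<And>t s. s \<in> krylov A u t \<Longrightarrow> s \<bullet> (A *v s) \<ge> 0"
  shows "u \<bullet> v = 0"
proof -
  let ?K = "\<Union>t. krylov A u t"
  have sub: "subspace ?K"
  proof (rule subspaceI)
    show "0 \<in> ?K" using subspace_0[OF subspace_krylov] by blast
    fix x y assume "x \<in> ?K" "y \<in> ?K"
    then obtain i j where "x \<in> krylov A u i" "y \<in> krylov A u j" by blast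
    then have "x \<in> krylov A u (max i j)" "y \<in> krylov A u (max i j)"
      using krylov_mono[of i "max i j" A u] krylov_mono[of j "max i j" A u] by auto
    then show "x + y \<in> ?K" using subspace_add[OF subspace_krylov] by blast
  next
    fix c x assume "x \<in> ?K"
    then show "c *\<^sub>R x \<in> ?K" using subspace_scale[OF subspace_krylov] by blast
  qed
  have inv: "A *v y \<in> ?K" if "y \<in> ?K" for y
    using that matrix_image_krylov by blast
  obtain w z where w: "w \<in> ?K" and z: "\<And>y. y \<in> ?K \<Longrightarrow> orthogonal z y" and vwz: "v = w + z"
    using orthogonal_subspace_decomp_exists[of ?K v] sub by (metis span_eq_iff)
  (* the component of v along the invariant space is again an eigenvector for mu *)
  have "A *v w - \<mu> *\<^sub>R w \<in> ?K" by (intro subspace_diff subspace_scale sub inv w)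
  moreover have "(A *v w - \<mu> *\<^sub>R w) \<bullet> y = 0" if y: "y \<in> ?K" for y
  proof -
    have "A *v w - \<mu> *\<^sub>R w = \<mu> *\<^sub>R z - A *v z"
      using v(1) by (simp add: vwz matrix_vector_right_distrib algebra_simps)
    then show ?thesis
      using z[OF y] z[OF inv[OF y]] sym[of z y] by (simp add: inner_diff_left orthogonal_def)
  qed
  ultimately have "(A *v w - \<mu> *\<^sub>R w) \<bullet> (A *v w - \<mu> *\<^sub>R w) = 0" by blast
  then have "A *v w = \<mu> *\<^sub>R w" by simp
  then have "0 \<le> \<mu> * (w \<bullet> w)" using w psd[of w] by auto
  then have "w \<bullet> w \<le> 0" using v(2) by (simp add: zero_le_mult_iff)
  then have "w = 0" by (metis inner_eq_zero_iff inner_ge_zero order_antisym)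
  then show ?thesis using z[of u] start_in_krylov[of u A 0] vwz by (auto simp: orthogonal_def inner_commute)
qed

text \<open>
  With tolerance zero the residual \<open>r\<close> at acceptance satisfies \<open>A r = 0\<close>, hence has curvature zero,
  and it would have been flagged as NPC unless \<open>r = 0\<close>. So the Krylov spaces are exhausted and \<open>A\<close> is
  positive definite on all of them.
\<close>

lemma minres_SOL_imp_krylov_psd:
  fixes A :: "real^'d^'d"
  assumes sym: "\<And>x y. (A *v x) \<bullet> y = x \<bullet> (A *v y)"
    and "minres_returns A u 0 SOL d" and s: "s \<in> krylov A u t"
  shows "s \<bullet> (A *v s) \<ge> 0"
proof -
  obtain n where no: "cr_no_npc A u (Suc n)" and r: "norm (A *v cr_residual A u n) \<le> 0 * norm (A *v d)"
    using minres_returns_SOL[OF sym assms(2)] by metis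
  have no': "cr_no_npc A u n" using no by (auto simp: cr_no_npc_def)
  have "cr_residual A u n = 0" using no r by (auto simp: cr_no_npc_def)
  then have "krylov A u (Suc n) \<subseteq> span (insert 0 (krylov A u n))"
    using krylov_Suc_subset_cr[OF sym no'] by simp
  then have st: "krylov A u (Suc n) \<subseteq> krylov A u n"
    by (simp add: span_insert_0 subspace_krylov span_eq_iff[THEN iffD2])
  have sn: "s \<in> krylov A u n"
    using s krylov_mono[of t n A u] krylov_stationary[OF st, of t] by (cases "t \<le> n") auto
  show ?thesis
  proof (cases "s = 0")
    case False
    show ?thesis by (rule less_imp_le[OF krylov_positive_definite[OF sym no' sn False]])
  qed simp
qed

section \<open>Taylor bounds\<close>

lemma continuous_on_matrix_vector_mult [continuous_intros]:
  fixes A :: "'a::topological_space \<Rightarrow> real^'n^'m"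
  assumes "continuous_on S A" "continuous_on S v"
  shows "continuous_on S (\<lambda>x. A x *v v x)"
  unfolding matrix_vector_mult_def
  by (intro continuous_intros assms)

locale lipschitz_hessian =
  fixes f :: "real^'d \<Rightarrow> real" and g :: "real^'d \<Rightarrow> real^'d" and H :: "real^'d \<Rightarrow> real^'d^'d"
    and L :: real
  assumes grad: "\<And>x. GDERIV f x :> g x"
    and hess: "\<And>x. (g has_derivative (\<lambda>h. H x *v h)) (at x)"
    and hess_cont: "continuous_on UNIV H"
    and L_pos: "0 < L" and lip: "hessian_lipschitz H L"
begin

lemma value_along_line:
  "((\<lambda>t. f (x + t *\<^sub>R d)) has_real_derivative g (x + t *\<^sub>R d) \<bullet> d) (at t)"
proof -
  have "((\<lambda>t. x + t *\<^sub>R d) has_derivative (\<lambda>t. t *\<^sub>R d)) (at t)"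
    by (auto intro!: derivative_eq_intros)
  from has_derivative_compose[OF this grad[unfolded gderiv_def]]
  show ?thesis
    unfolding has_field_derivative_def
    by (simp add: inner_commute[of d] mult.commute[of _ "_ \<bullet> _"])
qed

lemma gradient_along_line:
  "((\<lambda>t. e \<bullet> g (x + t *\<^sub>R d)) has_real_derivative e \<bullet> (H (x + t *\<^sub>R d) *v d)) (at t)"
proof -
  have "((\<lambda>t. x + t *\<^sub>R d) has_derivative (\<lambda>t. t *\<^sub>R d)) (at t)"
    by (auto intro!: derivative_eq_intros)
  from has_derivative_compose[OF this hess]
  have "((\<lambda>t. e \<bullet> g (x + t *\<^sub>R d)) has_derivative (\<lambda>t'. e \<bullet> (H (x + t *\<^sub>R d) *v (t' *\<^sub>R d)))) (at t)"
    by (rule has_derivative_inner_right)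
  then show ?thesis
    unfolding has_field_derivative_def by (simp add: matrix_vector_mult_scaleR mult.commute[of _ "_ \<bullet> _"])
qed

text \<open>
  Two applications of the mean value theorem turn the second-order mixed difference into a value
  of the Hessian near \<open>x\<close>. The difference is symmetric in \<open>h\<close> and \<open>k\<close>, which gives the symmetry of
  the Hessian in the limit.
\<close>

lemma mixed_difference:
  assumes "t > 0"
  obtains p where "dist p x \<le> t * (norm h + norm k)"
    "f (x + t *\<^sub>R h + t *\<^sub>R k) - f (x + t *\<^sub>R h) - f (x + t *\<^sub>R k) + f x = t\<^sup>2 * (h \<bullet> (H p *v k))"
proof -
  define \<phi> where "\<phi> = (\<lambda>s. f ((x + t *\<^sub>R k) + s *\<^sub>R h) - f (x + s *\<^sub>R h))"
  have "(\<phi> has_real_derivative g ((x + t *\<^sub>R k) + s *\<^sub>R h) \<bullet> h - g (x + s *\<^sub>R h) \<bullet> h) (at s)" for s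
    unfolding \<phi>_def by (intro DERIV_diff value_along_line)
  from MVT2[OF assms this]
  obtain s where s: "0 < s" "s < t"
    "\<phi> t - \<phi> 0 = t * (g ((x + t *\<^sub>R k) + s *\<^sub>R h) \<bullet> h - g (x + s *\<^sub>R h) \<bullet> h)"
    by auto
  from MVT2[OF assms gradient_along_line[of h "x + s *\<^sub>R h" k]]
  obtain r where r: "0 < r" "r < t"
    "h \<bullet> g (x + s *\<^sub>R h + t *\<^sub>R k) - h \<bullet> g (x + s *\<^sub>R h) = t * (h \<bullet> (H (x + s *\<^sub>R h + r *\<^sub>R k) *v k))"
    by auto
  show ?thesis
  proof (rule that[of "x + s *\<^sub>R h + r *\<^sub>R k"])
    have "norm (s *\<^sub>R h + r *\<^sub>R k) \<le> s * norm h + r * norm k"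
      using s r by (intro norm_triangle_le) simp
    also have "\<dots> \<le> t * norm h + t * norm k"
      using s r by (intro add_mono mult_right_mono) auto
    finally show "dist (x + s *\<^sub>R h + r *\<^sub>R k) x \<le> t * (norm h + norm k)"
      by (simp add: dist_norm algebra_simps)
    have "x + t *\<^sub>R k + s *\<^sub>R h = x + s *\<^sub>R h + t *\<^sub>R k" by simp
    note s' = s(3)[unfolded this inner_commute[of _ h] r(3)]
    have "x + t *\<^sub>R k + t *\<^sub>R h = x + t *\<^sub>R h + t *\<^sub>R k" by simp
    with s' show "f (x + t *\<^sub>R h + t *\<^sub>R k) - f (x + t *\<^sub>R h) - f (x + t *\<^sub>R k) + f x
        = t\<^sup>2 * (h \<bullet> (H (x + s *\<^sub>R h + r *\<^sub>R k) *v k))"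
      by (simp add: \<phi>_def power2_eq_square)
  qed
qed

lemma hessian_symmetric: "(H x *v h) \<bullet> k = h \<bullet> (H x *v k)"
proof -
  define C where "C = norm h + norm k"
  have lim: "(\<lambda>n. u \<bullet> (H (P n) *v v)) \<longlonglongrightarrow> u \<bullet> (H x *v v)"
    if "\<And>n. dist (P n) x \<le> 1 / real (Suc n) * C" for P u v
  proof -
    have C0: "(\<lambda>n. 1 / real (Suc n) * C) \<longlonglongrightarrow> 0"
      using tendsto_mult_left_zero[OF LIMSEQ_inverse_real_of_nat, of C] by (simp add: inverse_eq_divide)
    have "(\<lambda>n. dist (P n) x) \<longlonglongrightarrow> 0"
      by (rule tendsto_sandwich[OF _ _ tendsto_const C0])
        (intro always_eventually allI zero_le_dist that)+
    then have Px: "P \<longlonglongrightarrow> x" by (rule tendsto_dist_iff[THEN iffD2])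
    have "continuous_on UNIV (\<lambda>p. u \<bullet> (H p *v v))"
      by (intro continuous_intros hess_cont)
    then have "isCont (\<lambda>p. u \<bullet> (H p *v v)) x"
      by (simp add: continuous_on_eq_continuous_at)
    from isCont_tendsto_compose[OF this Px] show ?thesis .
  qed
  have "\<exists>p q. dist p x \<le> 1 / real (Suc n) * C \<and> dist q x \<le> 1 / real (Suc n) * C \<and>
      h \<bullet> (H p *v k) = k \<bullet> (H q *v h)" for n
  proof -
    let ?t = "1 / real (Suc n)"
    have t: "?t > 0" by simp
    obtain p where p: "dist p x \<le> ?t * C"
      "f (x + ?t *\<^sub>R h + ?t *\<^sub>R k) - f (x + ?t *\<^sub>R h) - f (x + ?t *\<^sub>R k) + f x = ?t\<^sup>2 * (h \<bullet> (H p *v k))"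
      using mixed_difference[OF t, of x h k] unfolding C_def by blast
    obtain q where q: "dist q x \<le> ?t * (norm k + norm h)"
      "f (x + ?t *\<^sub>R k + ?t *\<^sub>R h) - f (x + ?t *\<^sub>R k) - f (x + ?t *\<^sub>R h) + f x = ?t\<^sup>2 * (k \<bullet> (H q *v h))"
      using mixed_difference[OF t, of x k h] by blast
    have c: "x + ?t *\<^sub>R k + ?t *\<^sub>R h = x + ?t *\<^sub>R h + ?t *\<^sub>R k" by simp
    have "?t\<^sup>2 * (h \<bullet> (H p *v k)) = ?t\<^sup>2 * (k \<bullet> (H q *v h))" 
      using p(2) q(2)[unfolded c] by linarith
    moreover have "?t\<^sup>2 \<noteq> 0" using t by simp
    ultimately have "h \<bullet> (H p *v k) = k \<bullet> (H q *v h)" using mult_left_cancel by blast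
    then show ?thesis using p(1) q(1) by (auto simp: C_def add.commute)
  qed
  then obtain P Q where P: "\<And>n. dist (P n) x \<le> 1 / real (Suc n) * C"
    and Q: "\<And>n. dist (Q n) x \<le> 1 / real (Suc n) * C"
    and PQ: "\<And>n. h \<bullet> (H (P n) *v k) = k \<bullet> (H (Q n) *v h)"
    by metis
  have "(\<lambda>n. h \<bullet> (H (P n) *v k)) \<longlonglongrightarrow> k \<bullet> (H x *v h)"
    unfolding PQ by (rule lim[OF Q])
  with lim[OF P, of h k] have "h \<bullet> (H x *v k) = k \<bullet> (H x *v h)" using LIMSEQ_unique by blast
  then show ?thesis by (simp add: inner_commute)
qed

lemma hessian_difference: "norm (H (x + d) *v v - H x *v v) \<le> L * norm d * norm v"
proof -
  have "norm ((H (x + d) - H x) *v v) \<le> spectral_norm (H (x + d) - H x) * norm v"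
    unfolding spectral_norm_def by (rule onorm[OF matrix_vector_mul_bounded_linear])
  also have "\<dots> \<le> L * norm (x + d - x) * norm v"
    using lip unfolding hessian_lipschitz_def by (intro mult_right_mono norm_ge_zero) blast
  finally show ?thesis by (simp add: matrix_vector_mult_diff_rdistrib)
qed

lemma gradient_taylor: "norm (g (x + d) - g x - H x *v d) \<le> L / 2 * (norm d)\<^sup>2"
proof -
  (* test the remainder against the unit vector in its own direction to reduce to one variable *)
  define v where "v = g (x + d) - g x - H x *v d"
  define e where "e = v /\<^sub>R norm v"
  have e1: "norm e \<le> 1" by (cases "v = 0") (simp_all add: e_def)
  define \<psi> where "\<psi> = (\<lambda>t. e \<bullet> g (x + t *\<^sub>R d) - t * (e \<bullet> (H x *v d)) - L / 2 * (norm d)\<^sup>2 * t\<^sup>2)"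
  have "\<psi> 1 \<le> \<psi> 0"
  proof (rule DERIV_nonpos_imp_nonincreasing[of 0 1])
    fix t :: real assume t: "0 \<le> t" "t \<le> 1"
    have D: "(\<psi> has_real_derivative
        e \<bullet> (H (x + t *\<^sub>R d) *v d) - e \<bullet> (H x *v d) - L / 2 * (norm d)\<^sup>2 * (2 * t)) (at t)"
      unfolding \<psi>_def by (intro DERIV_diff gradient_along_line) (auto intro!: derivative_eq_intros)
    have "e \<bullet> (H (x + t *\<^sub>R d) *v d) - e \<bullet> (H x *v d) \<le> L * t * (norm d)\<^sup>2"
    proof -
      have "e \<bullet> (H (x + t *\<^sub>R d) *v d - H x *v d) \<le> norm e * norm (H (x + t *\<^sub>R d) *v d - H x *v d)"
        by (rule norm_cauchy_schwarz)
      also have "\<dots> \<le> 1 * (L * norm (t *\<^sub>R d) * norm d)"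
        by (intro mult_mono hessian_difference e1) auto
      finally show ?thesis using t by (simp add: inner_diff_right power2_eq_square)
    qed
    then have "e \<bullet> (H (x + t *\<^sub>R d) *v d) - e \<bullet> (H x *v d) - L / 2 * (norm d)\<^sup>2 * (2 * t) \<le> 0"
      by (simp add: ac_simps)
    with D show "\<exists>y. (\<psi> has_real_derivative y) (at t) \<and> y \<le> 0" by blast
  qed simp
  then have "e \<bullet> v \<le> L / 2 * (norm d)\<^sup>2" by (simp add: \<psi>_def v_def inner_diff_right)
  moreover have "e \<bullet> v = norm v"
    by (cases "v = 0") (simp_all add: e_def dot_square_norm power2_eq_square)
  ultimately show ?thesis by (simp add: v_def)
qed

lemma value_taylor:
  "f (x + d) \<le> f x + g x \<bullet> d + 1/2 * (d \<bullet> (H x *v d)) + L / 6 * (norm d) ^ 3"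
proof -
  define \<psi> where "\<psi> = (\<lambda>t. f (x + t *\<^sub>R d) - t * (g x \<bullet> d) - t\<^sup>2 / 2 * (d \<bullet> (H x *v d))
      - L / 6 * (norm d) ^ 3 * t ^ 3)"
  have "\<psi> 1 \<le> \<psi> 0"
  proof (rule DERIV_nonpos_imp_nonincreasing[of 0 1])
    fix t :: real assume t: "0 \<le> t" "t \<le> 1"
    let ?D = "g (x + t *\<^sub>R d) \<bullet> d - g x \<bullet> d - t * (d \<bullet> (H x *v d)) - L / 2 * (norm d) ^ 3 * t\<^sup>2"
    have D: "(\<psi> has_real_derivative ?D) (at t)"
      unfolding \<psi>_def by (intro DERIV_diff value_along_line) (auto intro!: derivative_eq_intros)
    have "(g (x + t *\<^sub>R d) - g x - H x *v (t *\<^sub>R d)) \<bullet> d \<le> L / 2 * (norm d) ^ 3 * t\<^sup>2"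
    proof -
      have "(g (x + t *\<^sub>R d) - g x - H x *v (t *\<^sub>R d)) \<bullet> d
          \<le> norm (g (x + t *\<^sub>R d) - g x - H x *v (t *\<^sub>R d)) * norm d"
        by (rule norm_cauchy_schwarz)
      also have "\<dots> \<le> L / 2 * (norm (t *\<^sub>R d))\<^sup>2 * norm d"
        by (intro mult_right_mono gradient_taylor) auto
      finally show ?thesis by (simp add: power_mult_distrib power3_eq_cube power2_eq_square ac_simps)
    qed
    then have "?D \<le> 0"
      by (simp add: inner_diff_left matrix_vector_mult_scaleR inner_commute[of d])
    with D show "\<exists>y. (\<psi> has_real_derivative y) (at t) \<and> y \<le> 0" by blast
  qed simp
  then show ?thesis by (simp add: \<psi>_def)
qed

lemma value_taylor_step:
  assumes "0 \<le> a"
  shows "f (x + a *\<^sub>R d) \<le> f x + a * (g x \<bullet> d) + a\<^sup>2 / 2 * (d \<bullet> (H x *v d)) + L / 6 * a ^ 3 * (norm d) ^ 3"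
  using value_taylor[of x "a *\<^sub>R d"] assms
  by (simp add: matrix_vector_mult_scaleR power2_eq_square power3_eq_cube ac_simps)

section \<open>Line searches\<close>

text \<open>
  Put \<open>\<tau> = 3 * \<sigma> * (1 - 2 * \<rho>) / L\<close>. Any \<open>a \<le> 1\<close> with \<open>a\<^sup>2 * norm d \<le> \<tau>\<close> passes the line search, since
  then the cubic term is covered by the slack \<open>1/2 - \<rho>\<close> in the curvature term. If \<open>norm d \<le> \<tau>\<close> this
  admits the unit step; otherwise the longest such \<open>a\<close> is \<open>sqrt (\<tau> / norm d)\<close>, and the factor
  \<open>norm d > \<tau>\<close> makes the decrease at least \<open>\<rho> * \<sigma> * \<tau>\<^sup>2\<close>.
\<close>

lemma SOL_decrease:
  assumes big: "is_largest (\<lambda>a. 0 < a \<and> a \<le> 1 \<and> f (x + a *\<^sub>R d) \<le> f x + \<rho> * a * (g x \<bullet> d)) \<alpha>"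
    and gd: "g x \<bullet> d \<le> - (d \<bullet> (H x *v d))" and pd: "d \<bullet> (H x *v d) \<ge> \<sigma> * (norm d)\<^sup>2"
    and pos: "0 < \<sigma>" "0 < \<rho>" "\<rho> < 1/2"
  shows "\<rho> * \<sigma> * (3 * \<sigma> * (1 - 2 * \<rho>) / L)\<^sup>2 \<le> f x - f (x + \<alpha> *\<^sub>R d) \<or>
    \<alpha> = 1 \<and> \<rho> * \<sigma> * (norm d)\<^sup>2 \<le> f x - f (x + \<alpha> *\<^sub>R d)"
proof -
  define \<tau> n where "\<tau> = 3 * \<sigma> * (1 - 2 * \<rho>) / L" and "n = norm d"
  have \<tau>: "\<tau> > 0" using pos L_pos by (simp add: \<tau>_def)
  have \<tau>L: "L / 6 * \<tau> = \<sigma> * (1/2 - \<rho>)" using L_pos by (simp add: \<tau>_def field_simps)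
  have \<alpha>: "0 < \<alpha>" "\<alpha> \<le> 1" "f (x + \<alpha> *\<^sub>R d) \<le> f x + \<rho> * \<alpha> * (g x \<bullet> d)"
    and max: "\<And>b. 0 < b \<Longrightarrow> b \<le> 1 \<Longrightarrow> f (x + b *\<^sub>R d) \<le> f x + \<rho> * b * (g x \<bullet> d) \<Longrightarrow> b \<le> \<alpha>"
    using big by (auto simp: is_largest_def)
  have ok: "a \<le> \<alpha>" if a: "0 < a" "a \<le> 1" "a\<^sup>2 * n \<le> \<tau>" for a
  proof (rule max[OF a(1,2)])
    let ?q = "d \<bullet> (H x *v d)" and ?G = "g x \<bullet> d"
    have q0: "?q \<ge> 0" using pd pos by (smt (verit) mult_nonneg_nonneg zero_le_power2)
    have "L / 6 * a ^ 3 * n ^ 3 = (a * n\<^sup>2 * (L / 6)) * (a\<^sup>2 * n)"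
      by (simp add: power2_eq_square power3_eq_cube)
    also have "\<dots> \<le> (a * n\<^sup>2 * (L / 6)) * \<tau>"
      using a L_pos by (intro mult_left_mono) auto
    also have "\<dots> = a * (1/2 - \<rho>) * (\<sigma> * n\<^sup>2)" using \<tau>L by (simp add: ac_simps)
    also have "\<dots> \<le> a * (1/2 - \<rho>) * ?q"
      using a pos pd by (intro mult_left_mono) (auto simp: n_def)
    finally have 1: "L / 6 * a ^ 3 * n ^ 3 \<le> a * (1/2 - \<rho>) * ?q" .
    have "a * a * ?q \<le> a * 1 * ?q" using a q0 by (intro mult_right_mono mult_left_mono) auto
    then have 2: "a\<^sup>2 / 2 * ?q \<le> a / 2 * ?q" by (simp add: power2_eq_square)
    have 3: "(1 - \<rho>) * a * ?G \<le> (1 - \<rho>) * a * (- ?q)"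
      using a pos gd by (intro mult_left_mono) auto
    show "f (x + a *\<^sub>R d) \<le> f x + \<rho> * a * ?G"
      using value_taylor_step[of a x d] a 1 2 3 by (simp add: n_def algebra_simps)
  qed
  have dec: "\<rho> * \<sigma> * (\<alpha> * n\<^sup>2) \<le> f x - f (x + \<alpha> *\<^sub>R d)"
  proof -
    have "\<rho> * \<alpha> * (\<sigma> * n\<^sup>2) \<le> \<rho> * \<alpha> * (- (g x \<bullet> d))"
      using pos \<alpha> gd pd by (intro mult_left_mono) (auto simp: n_def)
    then show ?thesis using \<alpha>(3) by (simp add: algebra_simps)
  qed
  show ?thesis
  proof (cases "n \<le> \<tau>")
    case True
    then have "\<alpha> = 1" using ok[of 1] \<alpha>(2) by simp
    then show ?thesis using dec by (simp add: n_def)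
  next
    case False
    define a where "a = sqrt (\<tau> / n)"
    have n: "n > \<tau>" "n > 0" using False \<tau> by auto
    have a2: "a\<^sup>2 = \<tau> / n" using \<tau> n by (simp add: a_def)
    have a: "0 < a" "a \<le> 1" using \<tau> n by (auto simp: a_def)
    have "a \<le> \<alpha>" using ok[OF a] a2 n by simp
    have "\<tau>\<^sup>2 \<le> \<tau> * n" using n \<tau> by (simp add: power2_eq_square)
    also have "\<tau> * n = a\<^sup>2 * n\<^sup>2" using a2 n by (simp add: power2_eq_square)
    also have "\<dots> \<le> a * n\<^sup>2" using a by (intro mult_right_mono) (auto simp: power2_eq_square mult_left_le)
    also have "\<dots> \<le> \<alpha> * n\<^sup>2" using \<open>a \<le> \<alpha>\<close> by (intro mult_right_mono) auto
    finally have "\<rho> * \<sigma> * \<tau>\<^sup>2 \<le> \<rho> * \<sigma> * (\<alpha> * n\<^sup>2)" using pos by (intro mult_left_mono) auto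
    then show ?thesis using dec by (simp add: \<tau>_def)
  qed
qed

text \<open>
  The curvature term only helps, so the linear term has to pay for the cubic one, which it does
  up to \<open>a = sqrt (6 * (1 - \<rho>) / (L * norm d))\<close>.
\<close>

lemma NPC_decrease:
  assumes big: "is_largest (\<lambda>a. 0 < a \<and> f (x + a *\<^sub>R d) \<le> f x + \<rho> * a * (g x \<bullet> d)) \<alpha>"
    and gd: "g x \<bullet> d = - (norm d)\<^sup>2" and npc: "d \<bullet> (H x *v d) \<le> 0" and "d \<noteq> 0"
    and pos: "0 < \<rho>" "\<rho> < 1"
  shows "\<rho> * sqrt (6 * (1 - \<rho>) / L) * norm d powr (3/2) \<le> f x - f (x + \<alpha> *\<^sub>R d)"
proof -
  define \<kappa> n where "\<kappa> = 6 * (1 - \<rho>) / L" and "n = norm d"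
  have n: "n > 0" using \<open>d \<noteq> 0\<close> by (simp add: n_def)
  have \<kappa>: "\<kappa> > 0" "L / 6 * \<kappa> = 1 - \<rho>" using pos L_pos by (auto simp: \<kappa>_def)
  define a where "a = sqrt (\<kappa> / n)"
  have a: "a > 0" "a\<^sup>2 * n = \<kappa>" using n \<kappa> by (auto simp: a_def)
  have \<alpha>: "0 < \<alpha>" "f (x + \<alpha> *\<^sub>R d) \<le> f x + \<rho> * \<alpha> * (g x \<bullet> d)"
    and max: "\<And>b. 0 < b \<Longrightarrow> f (x + b *\<^sub>R d) \<le> f x + \<rho> * b * (g x \<bullet> d) \<Longrightarrow> b \<le> \<alpha>"
    using big by (auto simp: is_largest_def)
  have "a \<le> \<alpha>"
  proof (rule max[OF a(1)])
    have "L / 6 * a ^ 3 * n ^ 3 = a * n\<^sup>2 * (L / 6 * (a\<^sup>2 * n))"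
      by (simp add: power2_eq_square power3_eq_cube)
    also have "\<dots> = a * n\<^sup>2 * (1 - \<rho>)" using a \<kappa> by simp
    finally have 1: "L / 6 * a ^ 3 * n ^ 3 = a * n\<^sup>2 * (1 - \<rho>)" .
    have 2: "a\<^sup>2 / 2 * (d \<bullet> (H x *v d)) \<le> 0" using npc by (intro mult_nonneg_nonpos) auto
    show "f (x + a *\<^sub>R d) \<le> f x + \<rho> * a * (g x \<bullet> d)"
      using value_taylor_step[of a x d] a 1 2 gd by (simp add: n_def algebra_simps)
  qed
  have "sqrt \<kappa> * n powr (3/2) = a * n\<^sup>2"
  proof -
    have "n powr (3/2) = n powr 1 * n powr (1/2)" by (subst powr_add[symmetric]) simp
    then have "n powr (3/2) = n * sqrt n" using n by (simp add: powr_half_sqrt)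
    moreover have "sqrt n * sqrt n = n" using n by simp
    ultimately show ?thesis using n by (simp add: a_def real_sqrt_divide power2_eq_square field_simps)
  qed
  also have "\<dots> \<le> \<alpha> * n\<^sup>2" using \<open>a \<le> \<alpha>\<close> by (intro mult_right_mono) auto
  finally have "\<rho> * (sqrt \<kappa> * n powr (3/2)) \<le> \<rho> * (\<alpha> * n\<^sup>2)" using pos by (intro mult_left_mono) auto
  then show ?thesis using \<alpha>(2) gd by (simp add: \<kappa>_def n_def algebra_simps)
qed

text \<open>
  The linear term only helps; the curvature term pays for the cubic one up to
  \<open>a = 3 * (1 - \<rho>) * q / L\<close>, where \<open>- q\<close> is the curvature along \<open>d\<close>. The decrease is of order \<open>q ^ 3\<close>.
\<close>

lemma curvature_decrease:
  assumes big: "is_largest (\<lambda>a. 0 < a \<and>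
      f (x + a *\<^sub>R d) \<le> f x + 1/2 * \<rho> * a\<^sup>2 * (d \<bullet> (H x *v d))) \<alpha>"
    and gd: "g x \<bullet> d \<le> 0" and npc: "d \<bullet> (H x *v d) \<le> - (\<epsilon> / 2)" and "norm d = 1"
    and pos: "0 < \<rho>" "\<rho> < 1" "0 < \<epsilon>"
  shows "9 * \<rho> * (1 - \<rho>)\<^sup>2 / (16 * L\<^sup>2) * \<epsilon> ^ 3 \<le> f x - f (x + \<alpha> *\<^sub>R d)"
proof -
  define q where "q = - (d \<bullet> (H x *v d))"
  have q: "q \<ge> \<epsilon> / 2" "q > 0" and dHd: "d \<bullet> (H x *v d) = - q" using npc pos by (auto simp: q_def)
  define a where "a = 3 * (1 - \<rho>) * q / L"
  have a: "a > 0" "L * a = 3 * (1 - \<rho>) * q" using pos q L_pos by (auto simp: a_def)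
  have \<alpha>: "0 < \<alpha>" "f (x + \<alpha> *\<^sub>R d) \<le> f x + 1/2 * \<rho> * \<alpha>\<^sup>2 * (- q)"
    and max: "\<And>b. 0 < b \<Longrightarrow> f (x + b *\<^sub>R d) \<le> f x + 1/2 * \<rho> * b\<^sup>2 * (- q) \<Longrightarrow> b \<le> \<alpha>"
    using big unfolding is_largest_def dHd by auto
  have "a \<le> \<alpha>"
  proof (rule max[OF a(1)])
    have 1: "L / 6 * a ^ 3 = a\<^sup>2 / 6 * (L * a)" by (simp add: power2_eq_square power3_eq_cube)
    have 2: "a * (g x \<bullet> d) \<le> 0" using a gd by (intro mult_nonneg_nonpos) auto
    show "f (x + a *\<^sub>R d) \<le> f x + 1/2 * \<rho> * a\<^sup>2 * (- q)"
      using value_taylor_step[of a x d] a(1) 1[unfolded a(2)] 2 \<open>norm d = 1\<close>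
      by (simp add: dHd algebra_simps)
  qed
  then have "a\<^sup>2 \<le> \<alpha>\<^sup>2" using a by (intro power_mono) auto
  then have "1/2 * \<rho> * q * a\<^sup>2 \<le> 1/2 * \<rho> * q * \<alpha>\<^sup>2" using pos q by (intro mult_left_mono) auto
  moreover have "1/2 * \<rho> * q * a\<^sup>2 = 9 * \<rho> * (1 - \<rho>)\<^sup>2 / (2 * L\<^sup>2) * q ^ 3"
    by (simp add: a_def power2_eq_square power3_eq_cube) (simp add: algebra_simps)
  moreover have "9 * \<rho> * (1 - \<rho>)\<^sup>2 / (2 * L\<^sup>2) * (\<epsilon> / 2) ^ 3 \<le> 9 * \<rho> * (1 - \<rho>)\<^sup>2 / (2 * L\<^sup>2) * q ^ 3"
    using pos q by (intro mult_left_mono power_mono) auto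
  moreover have "9 * \<rho> * (1 - \<rho>)\<^sup>2 / (2 * L\<^sup>2) * (\<epsilon> / 2) ^ 3
      = 9 * \<rho> * (1 - \<rho>)\<^sup>2 / (16 * L\<^sup>2) * \<epsilon> ^ 3"
    by (simp add: power_divide)
  moreover have "1/2 * \<rho> * q * \<alpha>\<^sup>2 \<le> f x - f (x + \<alpha> *\<^sub>R d)"
    using \<alpha>(2) by (simp add: algebra_simps)
  ultimately show ?thesis by linarith
qed

end

section \<open>Measurability of the steps\<close>

text \<open>
  The set of \<open>y\<close> for which some \<open>a \<ge> c\<close> is admissible is a countable union of projections of closed
  sets along compact intervals, hence Borel. The largest admissible \<open>a\<close> is the supremum of the
  positive rationals \<open>c\<close> for which this set contains \<open>y\<close>.
\<close>

lemma measurable_largest: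
  fixes Q :: "real \<Rightarrow> 'a::euclidean_space \<Rightarrow> bool"
  assumes clo: "closed {p. Q (fst p) (snd p)}"
  shows "\<exists>\<alpha>\<in>borel_measurable borel. \<forall>y b. is_largest (\<lambda>a. 0 < a \<and> Q a y) b \<longrightarrow> \<alpha> y = b"
proof -
  define D where "D = (\<lambda>c. {y. \<exists>a\<ge>c. Q a y})"
  have D_meas: "D c \<in> sets borel" for c
  proof -
    have "D c = (\<Union>n. {y. \<exists>a. a \<in> {c..real n} \<and> (a, y) \<in> {p. Q (fst p) (snd p)}})"
      by (auto simp: D_def) (meson real_arch_simple)
    moreover have "closed {y. \<exists>a. a \<in> {c..real n} \<and> (a, y) \<in> {p. Q (fst p) (snd p)}}" for n
      by (intro closed_compact_projection clo) simp
    ultimately show ?thesis by (auto intro!: sets.countable_UN borel_closed)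
  qed
  define F where "F = (\<lambda>y (r::rat). if y \<in> D (of_rat r) then ereal (of_rat r) else 0)"
  define \<alpha> where "\<alpha> = (\<lambda>y. real_of_ereal (SUP r\<in>{0<..}. F y r))"
  show ?thesis
  proof (intro bexI[of _ \<alpha>] allI impI)
    fix y b assume "is_largest (\<lambda>a. 0 < a \<and> Q a y) b"
    then have b: "0 < b" "Q b y" and max: "\<And>a. 0 < a \<Longrightarrow> Q a y \<Longrightarrow> a \<le> b"
      by (auto simp: is_largest_def)
    have D_iff: "y \<in> D c \<longleftrightarrow> c \<le> b" if "0 < c" for c
    proof
      assume "y \<in> D c"
      then obtain a where a: "c \<le> a" "Q a y" by (auto simp: D_def)
      with max[of a] that show "c \<le> b" by linarith
    qed (use b in \<open>auto simp: D_def\<close>)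
    have "(SUP r\<in>{0<..}. F y r) = ereal b"
    proof (rule SUP_eqI)
      fix r :: rat assume "r \<in> {0<..}"
      then show "F y r \<le> ereal b" using D_iff[of "of_rat r"] b by (auto simp: F_def)
    next
      fix u assume u: "\<And>r. r \<in> {0<..} \<Longrightarrow> F y r \<le> u"
      show "ereal b \<le> u"
      proof (rule ccontr)
        assume "\<not> ereal b \<le> u"
        then have "u < ereal b" by simp
        then have "sup u 0 < ereal b" using b by (simp add: sup_max)
        from ereal_dense3[OF this]
        obtain r :: rat where "sup u 0 < ereal (of_rat r)" "ereal (of_rat r) < ereal b" by metis
        then have r: "u < ereal (of_rat r)" "0 < real_of_rat r" "real_of_rat r < b"
          by (simp_all add: sup_max)
        then have "0 < r" by simp
        then have "F y r = ereal (of_rat r)" using D_iff[of "of_rat r"] r by (simp add: F_def)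
        then show False using u[of r] \<open>0 < r\<close> r by simp
      qed
    qed
    then show "\<alpha> y = b" by (simp add: \<alpha>_def)
  next
    have "(\<lambda>y. F y r) \<in> borel_measurable borel" for r
      unfolding F_def using D_meas[of "of_rat r"] by (intro measurable_If_set) auto
    then show "\<alpha> \<in> borel_measurable borel"
      unfolding \<alpha>_def
      by (intro borel_measurable_real_of_ereal borel_measurable_SUP) auto
  qed
qed

lemma borel_measurable_matrix_vector_mult [measurable (raw)]:
  fixes A :: "'a \<Rightarrow> real^'n^'m"
  assumes "A \<in> borel_measurable M" "v \<in> borel_measurable M"
  shows "(\<lambda>x. A x *v v x) \<in> borel_measurable M"
  using assms
  by (rule borel_measurable_continuous_Pair) (intro continuous_intros)

lemma borel_measurable_cr:
  fixes A :: "'a \<Rightarrow> real^'d^'d"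
  assumes [measurable]: "A \<in> borel_measurable M" "b \<in> borel_measurable M"
  shows borel_measurable_cr_iterate: "(\<lambda>x. cr_iterate (A x) (b x) n) \<in> borel_measurable M"
    and borel_measurable_cr_residual: "(\<lambda>x. cr_residual (A x) (b x) n) \<in> borel_measurable M"
proof -
  have "(\<lambda>x. cr_iterate (A x) (b x) n) \<in> borel_measurable M \<and>
      (\<lambda>x. cr_direction (A x) (b x) n) \<in> borel_measurable M"
  proof (induction n)
    case (Suc n)
    then have [measurable]: "(\<lambda>x. cr_iterate (A x) (b x) n) \<in> borel_measurable M"
      "(\<lambda>x. cr_direction (A x) (b x) n) \<in> borel_measurable M" by auto
    have [measurable]: "(\<lambda>x. cr_residual (A x) (b x) n) \<in> borel_measurable M"
      unfolding cr_residual_def by measurable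
    have [measurable]: "(\<lambda>x. cr_step_length (A x) (b x) n) \<in> borel_measurable M"
      unfolding cr_step_length_def by measurable
    have [measurable]: "(\<lambda>x. cr_iterate (A x) (b x) (Suc n)) \<in> borel_measurable M"
      unfolding cr_iterate_Suc by measurable
    have [measurable]: "(\<lambda>x. cr_residual (A x) (b x) (Suc n)) \<in> borel_measurable M"
      unfolding cr_residual_def by measurable
    have "(\<lambda>x. cr_direction (A x) (b x) (Suc n)) \<in> borel_measurable M"
      unfolding cr_direction_Suc by measurable
    then show ?case by simp
  qed simp
  then show it [measurable]: "(\<lambda>x. cr_iterate (A x) (b x) n) \<in> borel_measurable M" by simp
  show "(\<lambda>x. cr_residual (A x) (b x) n) \<in> borel_measurable M"
    unfolding cr_residual_def by measurable
qed

lemma symmetric_plus_mat: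
  fixes A :: "real^'d^'d"
  assumes sym: "\<And>x y. (A *v x) \<bullet> y = x \<bullet> (A *v y)"
  shows "((A + mat c) *v x) \<bullet> y = x \<bullet> ((A + mat c) *v y)"
  by (simp add: matrix_vector_mult_add_rdistrib mat_mult_vec sym inner_add_left inner_add_right)

context lipschitz_hessian
begin

lemma continuous_on_value: "continuous_on UNIV f"
  using grad unfolding gderiv_def
  by (intro has_derivative_continuous_on) (auto intro: has_derivative_at_withinI)

lemma continuous_on_gradient: "continuous_on UNIV g"
  using hess by (intro has_derivative_continuous_on) (auto intro: has_derivative_at_withinI)

lemmas continuous_on_compose_fgH =
  continuous_on_compose2[OF continuous_on_value _ subset_UNIV]
  continuous_on_compose2[OF continuous_on_gradient _ subset_UNIV]
  continuous_on_compose2[OF hess_cont _ subset_UNIV]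

text \<open>
  A step is determined by the flag, the inner iteration at which MINRES stops, the sign, and the
  line search. Fixing the first three leaves a measurable map of the point and the draw, built from
  a conjugate residual iterate or residual and a measurable line search. Only countably many
  choices remain. Which of them the method makes at a given point need not be measurable.
\<close>

lemma countable_step_maps:
  obtains T where "countable T" "T \<subseteq> borel_measurable borel"
    "\<forall>x u x'. newton_mr_step f g H \<epsilon>\<^sub>g \<epsilon>\<^sub>H \<theta> \<rho>\<^sub>S \<rho>\<^sub>N \<rho>\<^sub>C x u x' \<longrightarrow> (\<exists>h\<in>T. x' = h (x, u))"
proof -
  let ?B = "borel :: ((real^'d) \<times> (real^'d)) measure"
  have fst_meas: "fst \<in> borel_measurable ?B" and snd_meas: "snd \<in> borel_measurable ?B"
    by (intro borel_measurable_continuous_onI continuous_intros)+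
  have H_meas: "(\<lambda>p. H (fst p)) \<in> borel_measurable ?B"
    and Hc_meas: "(\<lambda>p. H (fst p) + mat (\<epsilon>\<^sub>H / 2)) \<in> borel_measurable ?B"
    and g_meas: "(\<lambda>p. g (fst p)) \<in> borel_measurable ?B"
    by (intro borel_measurable_continuous_onI continuous_intros continuous_on_compose_fgH)+
  have pair_meas: "(\<lambda>p. \<alpha> (v p, w p)) \<in> borel_measurable ?B"
    if "\<alpha> \<in> borel_measurable borel" "v \<in> borel_measurable borel" "w \<in> borel_measurable borel"
    for \<alpha> :: "(real^'d) \<times> (real^'d) \<Rightarrow> real" and v w
    using measurable_compose[OF borel_measurable_Pair[OF that(2,3)] that(1)] .
  have "closed {p :: real \<times> (real^'d) \<times> (real^'d). fst p \<le> 1 \<and>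
      f (fst (snd p) + fst p *\<^sub>R snd (snd p))
        \<le> f (fst (snd p)) + \<rho>\<^sub>S * fst p * (g (fst (snd p)) \<bullet> snd (snd p))}"
    by (intro closed_Collect_conj closed_Collect_le continuous_intros continuous_on_compose_fgH)
  from measurable_largest[of "\<lambda>a y. a \<le> 1 \<and>
      f (fst y + a *\<^sub>R snd y) \<le> f (fst y) + \<rho>\<^sub>S * a * (g (fst y) \<bullet> snd y)", OF this]
  obtain \<alpha>S where \<alpha>S: "\<alpha>S \<in> borel_measurable borel"
    and \<alpha>S_eq: "\<forall>y b. is_largest (\<lambda>a. 0 < a \<and> a \<le> 1 \<and>
      f (fst y + a *\<^sub>R snd y) \<le> f (fst y) + \<rho>\<^sub>S * a * (g (fst y) \<bullet> snd y)) b \<longrightarrow> \<alpha>S y = b"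
    by (rule bexE)
  have "closed {p :: real \<times> (real^'d) \<times> (real^'d).
      f (fst (snd p) + fst p *\<^sub>R snd (snd p))
        \<le> f (fst (snd p)) + \<rho>\<^sub>N * fst p * (g (fst (snd p)) \<bullet> snd (snd p))}"
    by (intro closed_Collect_conj closed_Collect_le continuous_intros continuous_on_compose_fgH)
  from measurable_largest[of "\<lambda>a y.
      f (fst y + a *\<^sub>R snd y) \<le> f (fst y) + \<rho>\<^sub>N * a * (g (fst y) \<bullet> snd y)", OF this]
  obtain \<alpha>N where \<alpha>N: "\<alpha>N \<in> borel_measurable borel"
    and \<alpha>N_eq: "\<forall>y b. is_largest (\<lambda>a. 0 < a \<and>
      f (fst y + a *\<^sub>R snd y) \<le> f (fst y) + \<rho>\<^sub>N * a * (g (fst y) \<bullet> snd y)) b \<longrightarrow> \<alpha>N y = b"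
    by (rule bexE)
  have "closed {p :: real \<times> (real^'d) \<times> (real^'d).
      f (fst (snd p) + fst p *\<^sub>R snd (snd p))
        \<le> f (fst (snd p)) + 1/2 * \<rho>\<^sub>C * (fst p)\<^sup>2 * (snd (snd p) \<bullet> (H (fst (snd p)) *v snd (snd p)))}"
    by (intro closed_Collect_conj closed_Collect_le continuous_intros continuous_on_compose_fgH)
  from measurable_largest[of "\<lambda>a y. f (fst y + a *\<^sub>R snd y)
      \<le> f (fst y) + 1/2 * \<rho>\<^sub>C * a\<^sup>2 * (snd y \<bullet> (H (fst y) *v snd y))", OF this]
  obtain \<alpha>C where \<alpha>C: "\<alpha>C \<in> borel_measurable borel"
    and \<alpha>C_eq: "\<forall>y b. is_largest (\<lambda>a. 0 < a \<and> f (fst y + a *\<^sub>R snd y)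
      \<le> f (fst y) + 1/2 * \<rho>\<^sub>C * a\<^sup>2 * (snd y \<bullet> (H (fst y) *v snd y))) b \<longrightarrow> \<alpha>C y = b"
    by (rule bexE)
  define S where "S = (\<lambda>n (p :: (real^'d) \<times> (real^'d)).
    let x = fst p; d = cr_iterate (H x) (g x) n in x + \<alpha>S (x, d) *\<^sub>R d)"
  define N where "N = (\<lambda>n (p :: (real^'d) \<times> (real^'d)).
    let x = fst p; d = cr_residual (H x) (g x) n in x + \<alpha>N (x, d) *\<^sub>R d)"
  define C where "C = (\<lambda>s n (p :: (real^'d) \<times> (real^'d)).
    let x = fst p; r = cr_residual (H x + mat (\<epsilon>\<^sub>H / 2)) (snd p) n; d = - (s / norm r) *\<^sub>R r
    in x + \<alpha>C (x, d) *\<^sub>R d)"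
  show ?thesis
  proof (rule that[of "range S \<union> range N \<union> range (C 1) \<union> range (C (-1))"])
    show "countable (range S \<union> range N \<union> range (C 1) \<union> range (C (-1)))"
      by (intro countable_Un countable_image countableI_type)
  next
    show "range S \<union> range N \<union> range (C 1) \<union> range (C (-1)) \<subseteq> borel_measurable borel"
    proof
      fix h assume "h \<in> range S \<union> range N \<union> range (C 1) \<union> range (C (-1))"
      moreover have "S n \<in> borel_measurable borel" for n
        unfolding S_def Let_def
        by (intro borel_measurable_add borel_measurable_scaleR pair_meas \<alpha>S fst_meas
            borel_measurable_cr_iterate H_meas g_meas)
      moreover have "N n \<in> borel_measurable borel" for n
        unfolding N_def Let_def
        by (intro borel_measurable_add borel_measurable_scaleR pair_meas \<alpha>N fst_meas
            borel_measurable_cr_residual H_meas g_meas)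
      moreover have "C s n \<in> borel_measurable borel" for s n
      proof -
        have [measurable]: "(\<lambda>p. cr_residual (H (fst p) + mat (\<epsilon>\<^sub>H / 2)) (snd p) n) \<in> borel_measurable ?B"
          by (intro borel_measurable_cr_residual Hc_meas snd_meas)
        have d_meas: "(\<lambda>p. - (s / norm (cr_residual (H (fst p) + mat (\<epsilon>\<^sub>H / 2)) (snd p) n)) *\<^sub>R
            cr_residual (H (fst p) + mat (\<epsilon>\<^sub>H / 2)) (snd p) n) \<in> borel_measurable ?B"
          by (intro borel_measurable_scaleR borel_measurable_uminus borel_measurable_divide) measurable
        show ?thesis
          unfolding C_def Let_def
          by (intro borel_measurable_add borel_measurable_scaleR pair_meas[OF \<alpha>C fst_meas d_meas]
              fst_meas d_meas)
      qed
      ultimately show "h \<in> borel_measurable borel" by blast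
    qed
  next
    show "\<forall>x u x'. newton_mr_step f g H \<epsilon>\<^sub>g \<epsilon>\<^sub>H \<theta> \<rho>\<^sub>S \<rho>\<^sub>N \<rho>\<^sub>C x u x' \<longrightarrow>
        (\<exists>h\<in>range S \<union> range N \<union> range (C 1) \<union> range (C (-1)). x' = h (x, u))"
    proof (intro allI impI)
      fix x u x' assume step: "newton_mr_step f g H \<epsilon>\<^sub>g \<epsilon>\<^sub>H \<theta> \<rho>\<^sub>S \<rho>\<^sub>N \<rho>\<^sub>C x u x'"
      show "\<exists>h\<in>range S \<union> range N \<union> range (C 1) \<union> range (C (-1)). x' = h (x, u)"
      proof (cases "norm (g x) > \<epsilon>\<^sub>g")
        case True
        obtain flag d \<alpha> where ret: "minres_returns (H x) (g x) (\<theta> * sqrt \<epsilon>\<^sub>g) flag d"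
          and ls: "case flag of
             SOL \<Rightarrow> is_largest (\<lambda>a. 0 < a \<and> a \<le> 1 \<and>
                      f (x + a *\<^sub>R d) \<le> f x + \<rho>\<^sub>S * a * (g x \<bullet> d)) \<alpha>
           | NPC \<Rightarrow> is_largest (\<lambda>a. 0 < a \<and>
                      f (x + a *\<^sub>R d) \<le> f x + \<rho>\<^sub>N * a * (g x \<bullet> d)) \<alpha>"
          and x': "x' = x + \<alpha> *\<^sub>R d"
          using step unfolding newton_mr_step_def if_P[OF True] gradient_step_def by blast
        show ?thesis
        proof (cases flag)
          case NPC
          obtain n where "d = cr_residual (H x) (g x) n"
            using minres_returns_NPC[OF hessian_symmetric ret[unfolded NPC]] by metis
          moreover have "\<alpha>N (x, d) = \<alpha>" using ls NPC by (intro \<alpha>N_eq[rule_format]) simp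
          ultimately have "x' = N n (x, u)" by (simp add: N_def Let_def x')
          then show ?thesis by blast
        next
          case SOL
          obtain n where "d = cr_iterate (H x) (g x) n"
            using minres_returns_SOL[OF hessian_symmetric ret[unfolded SOL]] by metis
          moreover have "\<alpha>S (x, d) = \<alpha>" using ls SOL by (intro \<alpha>S_eq[rule_format]) simp
          ultimately have "x' = S n (x, u)" by (simp add: S_def Let_def x')
          then show ?thesis by blast
        qed
      next
        case False
        obtain r s d \<alpha> where ret: "minres_returns (H x + mat (\<epsilon>\<^sub>H / 2)) u 0 NPC r"
          and s: "s \<in> {-1, 1}" and d: "d = - (s / norm r) *\<^sub>R r"
          and ls: "is_largest (\<lambda>a. 0 < a \<and>
            f (x + a *\<^sub>R d) \<le> f x + 1/2 * \<rho>\<^sub>C * a\<^sup>2 * (d \<bullet> (H x *v d))) \<alpha>"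
          and x': "x' = x + \<alpha> *\<^sub>R d"
          using step unfolding newton_mr_step_def if_not_P[OF False] curvature_step_def by blast
        obtain n where r: "r = cr_residual (H x + mat (\<epsilon>\<^sub>H / 2)) u n"
          using minres_returns_NPC[OF symmetric_plus_mat[OF hessian_symmetric] ret] by metis
        have "\<alpha>C (x, d) = \<alpha>" using ls by (intro \<alpha>C_eq[rule_format]) simp
        then have "x' = C s n (x, u)" by (simp add: C_def Let_def x' d r[symmetric])
        then show ?thesis using s by blast
      qed
    qed
  qed
qed

end

section \<open>Random draws\<close>

text \<open>
  The processes \<open>x\<close> are quantified inside the almost sure statement, so the choice of step maps may
  depend on \<open>w\<close> arbitrarily, even on future draws. Enlarging to all countably many choice sequences
  makes each candidate for \<open>x k\<close> a measurable function of the draws before \<open>k\<close>, independent of draw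
  \<open>k\<close>, and a set whose sections are null is null for the product measure.
\<close>

lemma (in prob_space) AE_run_avoids:
  fixes G :: "nat \<Rightarrow> 'a \<Rightarrow> 'b::second_countable_topology" and x\<^sub>0 :: 'b
    and N :: "('b \<times> 'b) set"
  assumes indep: "indep_vars (\<lambda>_. borel) G UNIV" and dist: "\<And>k. distr M borel (G k) = U"
    and T: "countable T" "T \<subseteq> borel_measurable borel"
    and N: "N \<in> sets borel" "\<And>x. AE u in U. (x, u) \<notin> N"
  shows "AE w in M. \<forall>x k. x 0 = x\<^sub>0 \<longrightarrow> (\<forall>j<k. \<exists>h\<in>T. x (Suc j) = h (x j, G j w)) \<longrightarrow> (x k, G k w) \<notin> N"
proof -
  have Gm [measurable]: "random_variable borel (G k)" for k
    using indep by (auto simp: indep_vars_def)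
  interpret U: prob_space U
    using prob_space_distr[OF Gm] dist by metis
  have sets_U: "sets U = sets borel" using dist sets_distr by metis
  (* R k: the possible k-th iterates, as functions of the sequence of draws *)
  define R where "R = rec_nat {\<lambda>_. x\<^sub>0}
    (\<lambda>k R. (\<lambda>(h, \<Phi>). \<lambda>\<omega>::nat \<Rightarrow> 'b. h (\<Phi> \<omega>, \<omega> k)) ` (T \<times> R))"
  have R0: "R 0 = {\<lambda>_. x\<^sub>0}"
    and RS: "R (Suc k) = (\<lambda>(h, \<Phi>). \<lambda>\<omega>. h (\<Phi> \<omega>, \<omega> k)) ` (T \<times> R k)" for k
    by (simp_all add: R_def)
  have cR: "countable (R k)" for k
    by (induction k) (simp_all add: R0 RS T)
  have mR: "\<Phi> \<in> borel_measurable (PiM {..<m} (\<lambda>_. borel))" if "\<Phi> \<in> R k" "k \<le> m" for \<Phi> k m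
    using that
  proof (induction k arbitrary: \<Phi>)
    case (Suc k)
    then obtain h \<Psi> where h: "h \<in> T" "\<Psi> \<in> R k" "\<Phi> = (\<lambda>\<omega>. h (\<Psi> \<omega>, \<omega> k))" by (auto simp: RS)
    have "\<Psi> \<in> borel_measurable (PiM {..<m} (\<lambda>_. borel))" using Suc h by auto
    moreover have "(\<lambda>\<omega>. \<omega> k) \<in> borel_measurable (PiM {..<m} (\<lambda>_. borel))"
      using Suc by (intro measurable_component_singleton) auto
    ultimately show ?case
      unfolding h by (intro measurable_compose[OF borel_measurable_Pair subsetD[OF T(2)]] h)
  qed (simp add: R0)
  (* the candidates read only the first k draws, so any restriction to m \<ge> k of them will do *)
  have reach: "\<exists>\<Phi>\<in>R k. x k = \<Phi> (\<lambda>i\<in>{..<m}. G i w)"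
    if "x 0 = x\<^sub>0" "\<forall>j<k. \<exists>h\<in>T. x (Suc j) = h (x j, G j w)" "k \<le> m" for x k m w
    using that(2,3)
  proof (induction k)
    case (Suc k)
    have "\<forall>j<k. \<exists>h\<in>T. x (Suc j) = h (x j, G j w)" "k \<le> m" using Suc.prems by auto
    with Suc.IH obtain \<Phi> where \<Phi>: "\<Phi> \<in> R k" "x k = \<Phi> (\<lambda>i\<in>{..<m}. G i w)" by blast
    obtain h where h: "h \<in> T" "x (Suc k) = h (x k, G k w)" using Suc.prems by auto
    have Gk: "(\<lambda>i\<in>{..<m}. G i w) k = G k w" using Suc.prems by simp
    show ?case
    proof (rule bexI)
      show "x (Suc k) = (\<lambda>\<omega>. h (\<Phi> \<omega>, \<omega> k)) (\<lambda>i\<in>{..<m}. G i w)"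
        by (simp only: \<Phi>(2) h(2) Gk)
      show "(\<lambda>\<omega>. h (\<Phi> \<omega>, \<omega> k)) \<in> R (Suc k)"
        unfolding RS using \<Phi>(1) h(1) by force
    qed
  qed (simp add: R0 that(1))
  have main: "AE w in M. (\<Phi> (\<lambda>i\<in>{..<k}. G i w), G k w) \<notin> N" if \<Phi>: "\<Phi> \<in> R k" for \<Phi> k
  proof -
    let ?Y = "\<lambda>w. \<Phi> (\<lambda>i\<in>{..<k}. G i w)"
    have ind: "indep_var (PiM {..<k} (\<lambda>_. borel)) (\<lambda>w. \<lambda>i\<in>{..<k}. G i w)
        (PiM {k} (\<lambda>_. borel)) (\<lambda>w. \<lambda>i\<in>{k}. G i w)"
      by (intro indep_var_restrict[OF indep]) auto
    have comp: "(\<lambda>\<omega> :: nat \<Rightarrow> 'b. \<omega> k) \<in> PiM {k} (\<lambda>_. borel) \<rightarrow>\<^sub>M borel"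
      by (intro measurable_component_singleton) simp
    from indep_var_compose[OF ind mR[OF \<Phi> order_refl] comp]
    have "indep_var borel ?Y borel (G k)" by (simp add: comp_def)
    then have Ym: "random_variable borel ?Y"
      and joint: "distr M borel ?Y \<Otimes>\<^sub>M U = distr M (borel \<Otimes>\<^sub>M borel) (\<lambda>w. (?Y w, G k w))"
      using indep_var_distribution_eq[of borel ?Y borel "G k"] by (auto simp: dist)
    interpret Y: prob_space "distr M borel ?Y" by (rule prob_space_distr[OF Ym])
    interpret P: pair_sigma_finite "distr M borel ?Y" U ..
    have Nset: "N \<in> sets (borel \<Otimes>\<^sub>M borel)" using N(1) unfolding borel_prod .
    have sets_eq: "sets (distr M borel ?Y \<Otimes>\<^sub>M U) = sets (borel \<Otimes>\<^sub>M borel)"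
      by (rule sets_pair_measure_cong) (simp_all add: sets_U)
    have "AE z in distr M borel ?Y \<Otimes>\<^sub>M U. z \<notin> N"
    proof (rule P.AE_pair_measure)
      have "{z \<in> space (distr M borel ?Y \<Otimes>\<^sub>M U). z \<notin> N} = space (distr M borel ?Y \<Otimes>\<^sub>M U) - N" by auto
      then show "{z \<in> space (distr M borel ?Y \<Otimes>\<^sub>M U). z \<notin> N} \<in> sets (distr M borel ?Y \<Otimes>\<^sub>M U)"
        using Nset sets_eq by (metis sets.compl_sets)
    qed (use N(2) in auto)
    then have "AE z in distr M (borel \<Otimes>\<^sub>M borel) (\<lambda>w. (?Y w, G k w)). z \<notin> N" unfolding joint .
    moreover have "{z \<in> space (borel \<Otimes>\<^sub>M borel). z \<notin> N} \<in> sets (borel \<Otimes>\<^sub>M borel)"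
      using Nset sets.compl_sets[OF Nset] by (simp add: set_diff_eq)
    ultimately show ?thesis
      using Ym by (subst (asm) AE_distr_iff) auto
  qed
  have "AE w in M. \<forall>k. \<forall>\<Phi>\<in>R k. (\<Phi> (\<lambda>i\<in>{..<k}. G i w), G k w) \<notin> N"
    by (simp add: AE_all_countable AE_ball_countable cR main)
  then show ?thesis
  proof (eventually_elim, intro allI impI)
    fix w x k
    assume *: "\<forall>k. \<forall>\<Phi>\<in>R k. (\<Phi> (\<lambda>i\<in>{..<k}. G i w), G k w) \<notin> N"
      and "x 0 = x\<^sub>0" "\<forall>j<k. \<exists>h\<in>T. x (Suc j) = h (x j, G j w)"
    then show "(x k, G k w) \<notin> N" using reach[of x k w k] by auto
  qed
qed

lemma AE_uniform_sphere_not_orthogonal: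
  fixes v :: "real^'d"
  assumes "v \<noteq> 0"
  shows "AE u in uniform_sphere. u \<bullet> v \<noteq> 0"
proof -
  have "{w. v \<bullet> w = 0} \<in> null_sets lebesgue"
    using negligible_hyperplane[of v 0] assms by (simp add: negligible_iff_null_sets)
  moreover have "{w. v \<bullet> w = 0} \<in> sets borel" by (intro borel_closed closed_hyperplane)
  ultimately have "{w. v \<bullet> w = 0} \<in> null_sets lborel"
    by (simp add: null_sets_completion_iff)
  then have "AE w in lborel. v \<bullet> w \<noteq> 0" by (auto dest!: AE_not_in)
  moreover have "AE w in lborel. w \<noteq> (0 :: real^'d)" by (rule AE_lborel_singleton)
  ultimately have "AE w in lborel. (w /\<^sub>R norm w) \<bullet> v \<noteq> 0"
    by eventually_elim (simp add: inner_commute)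
  then have "AE w in uniform_measure lborel (ball 0 1). (w /\<^sub>R norm w) \<bullet> v \<noteq> 0"
    by (intro AE_uniform_measureI) auto
  moreover have "{u. u \<bullet> v \<noteq> 0} \<in> sets borel"
    by measurable
  ultimately show ?thesis
    unfolding uniform_sphere_def by (subst AE_distr_iff) auto
qed

section \<open>Unlucky draws\<close>

lemma krylov_sum:
  fixes A :: "real^'d^'d"
  assumes "s \<in> krylov A b t"
  obtains c where "s = (\<Sum>i<t. c i *\<^sub>R ((\<lambda>v. A *v v) ^^ i) b)"
proof -
  have "\<exists>c. s = (\<Sum>i<t. c i *\<^sub>R ((\<lambda>v. A *v v) ^^ i) b)"
    using assms
  proof (induction t arbitrary: s)
    case (Suc t)
    then obtain k w where "w \<in> krylov A b t" "s = k *\<^sub>R ((\<lambda>v. A *v v) ^^ t) b + w"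
      using mem_span_insert_subspace[OF subspace_krylov] by (metis krylov_Suc)
    moreover from this Suc.IH obtain c where "w = (\<Sum>i<t. c i *\<^sub>R ((\<lambda>v. A *v v) ^^ i) b)" by blast
    ultimately show ?case by (intro exI[of _ "c(t := k)"]) simp
  qed simp
  then show ?thesis using that by blast
qed

lemma sum_in_krylov:
  fixes A :: "real^'d^'d"
  shows "(\<Sum>i<t. c i *\<^sub>R ((\<lambda>v. A *v v) ^^ i) b) \<in> krylov A b t"
  unfolding krylov_def by (intro span_sum span_scale span_base) blast

context lipschitz_hessian
begin

text \<open>
  The pairs of a point with an insufficiently convex Hessian and a draw whose Krylov spaces do
  not reveal this. Quantifying over all Krylov vectors, instead of referring to the outcome
  of MINRES, makes the set visibly Borel: an open condition on the point intersected with a closed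
  one on the pair.
\<close>

definition unlucky :: "real \<Rightarrow> ((real^'d) \<times> (real^'d)) set" where
  "unlucky \<epsilon> = {p. (\<exists>v. v \<bullet> (H (fst p) *v v) < - \<epsilon> * (norm v)\<^sup>2) \<and>
     (\<forall>t. \<forall>s \<in> krylov (H (fst p) + mat (\<epsilon> / 2)) (snd p) t. s \<bullet> ((H (fst p) + mat (\<epsilon> / 2)) *v s) \<ge> 0)}"

text \<open>
  Writing Krylov vectors as combinations with fixed coefficients turns both conditions into a
  union of open sets and an intersection of closed sets, respectively.
\<close>

lemma unlucky_borel: "unlucky \<epsilon> \<in> sets borel"
proof -
  define A where "A = (\<lambda>p :: (real^'d) \<times> (real^'d). H (fst p) + mat (\<epsilon> / 2))"
  define w where "w = (\<lambda>c t p. \<Sum>i<t. c i *\<^sub>R ((\<lambda>v. A p *v v) ^^ i) (snd p))"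
  have contA: "continuous_on UNIV A"
    unfolding A_def by (intro continuous_intros continuous_on_compose_fgH)
  have "continuous_on UNIV (\<lambda>p. ((\<lambda>v. A p *v v) ^^ i) (snd p))" for i
  proof (induction i)
    case (Suc i)
    then show ?case unfolding matrix_vector_power_Suc by (intro continuous_intros contA)
  qed (simp add: continuous_intros)
  then have contw: "continuous_on UNIV (w c t)" for c t
    unfolding w_def by (intro continuous_intros)
  have op: "open (\<Union>v. {p. v \<bullet> (H (fst p) *v v) < - \<epsilon> * (norm v)\<^sup>2})"
    by (intro open_UN ballI open_Collect_less continuous_intros continuous_on_compose_fgH)
  have cl: "closed (\<Inter>c. \<Inter>t. {p. 0 \<le> w c t p \<bullet> (A p *v w c t p)})"
    by (intro closed_INT ballI closed_Collect_le continuous_intros contA contw)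
  have eq: "unlucky \<epsilon> = (\<Union>v. {p. v \<bullet> (H (fst p) *v v) < - \<epsilon> * (norm v)\<^sup>2}) \<inter>
      (\<Inter>c. \<Inter>t. {p. 0 \<le> w c t p \<bullet> (A p *v w c t p)})"
  proof -
    have A: "H (fst p) + mat (\<epsilon> / 2) = A p" for p by (simp add: A_def)
    have psd: "(\<forall>t. \<forall>s \<in> krylov (A p) (snd p) t. s \<bullet> (A p *v s) \<ge> 0) \<longleftrightarrow>
        (\<forall>c t. 0 \<le> w c t p \<bullet> (A p *v w c t p))" for p
    proof (intro iffI allI ballI)
      fix c t assume "\<forall>t. \<forall>s \<in> krylov (A p) (snd p) t. s \<bullet> (A p *v s) \<ge> 0"
      moreover have "w c t p \<in> krylov (A p) (snd p) t" unfolding w_def by (rule sum_in_krylov)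
      ultimately show "0 \<le> w c t p \<bullet> (A p *v w c t p)" by blast
    next
      fix t s assume "\<forall>c t. 0 \<le> w c t p \<bullet> (A p *v w c t p)" and s: "s \<in> krylov (A p) (snd p) t"
      moreover obtain c where "s = w c t p" unfolding w_def by (rule krylov_sum[OF s])
      ultimately show "0 \<le> s \<bullet> (A p *v s)" by blast
    qed
    have "unlucky \<epsilon> = {p. (\<exists>v. v \<bullet> (H (fst p) *v v) < - \<epsilon> * (norm v)\<^sup>2) \<and>
        (\<forall>c t. 0 \<le> w c t p \<bullet> (A p *v w c t p))}"
      by (simp only: unlucky_def A psd)
    then show ?thesis by blast
  qed
  show ?thesis unfolding eq by (intro sets.Int borel_open borel_closed op cl)
qed

lemma AE_not_unlucky:
  assumes "\<epsilon> > 0"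
  shows "AE u in uniform_sphere. (x, u) \<notin> unlucky \<epsilon>"
proof (cases "\<exists>v. v \<bullet> (H x *v v) < - \<epsilon> * (norm v)\<^sup>2")
  case False
  then show ?thesis by (simp add: unlucky_def)
next
  case True
  then obtain y where y: "y \<bullet> (H x *v y) < - \<epsilon> * (norm y)\<^sup>2" by blast
  then have "y \<noteq> 0" by auto
  then have ne: "(UNIV :: (real^'d) set) \<noteq> {0}" by blast
  obtain v where v: "norm v = 1" "H x *v v = (v \<bullet> (H x *v v)) *\<^sub>R v"
    and min: "\<forall>w\<in>UNIV. w \<bullet> (H x *v w) \<ge> (v \<bullet> (H x *v v)) * (norm w)\<^sup>2"
    using rayleigh_minimum_eigenvector[OF hessian_symmetric subspace_UNIV UNIV_I ne] by blast
  define m where "m = v \<bullet> (H x *v v)"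
  have "m * (norm y)\<^sup>2 < - \<epsilon> * (norm y)\<^sup>2" using min[rule_format, of y] y by (simp add: m_def)
  then have "m < - \<epsilon>" by (rule mult_right_less_imp_less) simp
  then have neg: "m + \<epsilon> / 2 < 0" using assms by simp
  have eig: "(H x + mat (\<epsilon> / 2)) *v v = (m + \<epsilon> / 2) *\<^sub>R v"
    unfolding matrix_vector_mult_add_rdistrib mat_mult_vec
    by (subst v(2)) (simp add: m_def algebra_simps)
  have "v \<noteq> 0" using v(1) by auto
  from AE_uniform_sphere_not_orthogonal[OF this] show ?thesis
  proof eventually_elim
    fix u :: "real^'d" assume "u \<bullet> v \<noteq> 0"
    then show "(x, u) \<notin> unlucky \<epsilon>"
      using krylov_psd_imp_orthogonal[OF symmetric_plus_mat[OF hessian_symmetric] eig neg, of u]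
      by (auto simp: unlucky_def)
  qed
qed

end

section \<open>Progress of one step\<close>

lemma is_iterate_Suc:
  "is_iterate g H \<epsilon>\<^sub>g \<epsilon>\<^sub>H u x (Suc k) \<longleftrightarrow>
     is_iterate g H \<epsilon>\<^sub>g \<epsilon>\<^sub>H u x k \<and> \<not> newton_mr_terminates g H \<epsilon>\<^sub>g \<epsilon>\<^sub>H (x k) (u k)"
  by (auto simp: is_iterate_def less_Suc_eq)

lemma is_iterate_antimono:
  "is_iterate g H \<epsilon>\<^sub>g \<epsilon>\<^sub>H u x k \<Longrightarrow> j \<le> k \<Longrightarrow> is_iterate g H \<epsilon>\<^sub>g \<epsilon>\<^sub>H u x j"
  by (auto simp: is_iterate_def)

text \<open>
  The factor of \<open>e\<close> in the conclusion is the positive root \<open>c\<close> of \<open>P / \<sigma> * c + L / 2 * c\<^sup>2 = 1\<close>, written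
  without cancellation. With \<open>P = \<theta> * L\<^sub>g\<close> it is the constant \<open>c\<^sub>0\<close>.
\<close>

lemma positive_root_bound:
  fixes P Q L \<sigma> e y :: real
  assumes "0 < \<sigma>" "0 < L" "0 \<le> P" "0 < e" "0 \<le> y"
    and Q: "Q = sqrt (P\<^sup>2 + 2 * \<sigma>\<^sup>2 * L)"
    and quad: "e\<^sup>2 \<le> P * e / \<sigma> * y + L / 2 * y\<^sup>2"
  shows "2 * \<sigma> / (P + Q) * e \<le> y"
proof (rule ccontr)
  define c where "c = 2 * \<sigma> / (P + Q)"
  have arg: "P\<^sup>2 + 2 * \<sigma>\<^sup>2 * L > 0" using assms by (intro add_nonneg_pos) auto
  then have Q2: "Q\<^sup>2 = P\<^sup>2 + 2 * \<sigma>\<^sup>2 * L" and Q0: "Q > 0" by (simp_all add: Q)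
  have PQ: "P + Q > 0" using Q0 assms(3) by linarith
  have c0: "c > 0" using PQ assms by (simp add: c_def)
  have cPQ: "c * (P + Q) = 2 * \<sigma>" using PQ by (simp add: c_def)
  have "P / \<sigma> * c + L / 2 * c\<^sup>2 = 1"
  proof -
    have "(P * c * 2 * \<sigma> + \<sigma>\<^sup>2 * L * c\<^sup>2) * 2 = (2 * P * c * (c * (P + Q)) + c\<^sup>2 * (Q\<^sup>2 - P\<^sup>2))"
      unfolding cPQ Q2 by (simp add: algebra_simps)
    also have "\<dots> = (c * (P + Q))\<^sup>2" by (simp add: power2_eq_square algebra_simps)
    finally have "P * c * 2 * \<sigma> + \<sigma>\<^sup>2 * L * c\<^sup>2 = 2 * \<sigma>\<^sup>2" unfolding cPQ by (simp add: power2_eq_square)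
    then have "\<sigma> * (P * c * 2 + \<sigma> * L * c\<^sup>2) = \<sigma> * (2 * \<sigma>)"
      by (simp add: power2_eq_square algebra_simps)
    then have "P * c * 2 + \<sigma> * L * c\<^sup>2 = 2 * \<sigma>" using assms(1) by simp
    then show ?thesis using assms(1) by (simp add: field_simps)
  qed
  moreover have "P * e / \<sigma> * (c * e) + L / 2 * (c * e)\<^sup>2 = e\<^sup>2 * (P / \<sigma> * c + L / 2 * c\<^sup>2)"
    by (simp add: power2_eq_square algebra_simps)
  ultimately have one: "e\<^sup>2 = P * e / \<sigma> * (c * e) + L / 2 * (c * e)\<^sup>2" by simp
  assume "\<not> 2 * \<sigma> / (P + Q) * e \<le> y"
  then have yc: "y < c * e" by (simp add: c_def)
  have "P * e / \<sigma> * y \<le> P * e / \<sigma> * (c * e)" using assms yc by (intro mult_left_mono) auto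
  moreover have "L / 2 * y\<^sup>2 < L / 2 * (c * e)\<^sup>2"
    using assms yc by (intro mult_strict_left_mono power_strict_mono) auto
  ultimately show False using quad one by linarith
qed

context lipschitz_hessian
begin

text \<open>
  A step along nonpositive curvature and a step shorter than one gain enough at once. For a unit
  step the new gradient is at most the residual plus the Taylor remainder. The residual lies
  in a Krylov space on which the Hessian is at least \<open>\<sigma>\<close>, so the acceptance test bounds it by a
  multiple of \<open>sqrt \<epsilon> * norm d\<close>. If the new gradient still exceeds \<open>\<epsilon>\<close>, then \<open>norm d \<ge> c\<^sub>0 * sqrt \<epsilon>\<close>,
  and the gain is of order \<open>\<epsilon>\<close>, which for \<open>\<epsilon> \<le> 1\<close> is at least \<open>\<epsilon> powr (3/2)\<close>.
\<close>

lemma gradient_step_progress: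
  assumes big: "\<epsilon> < norm (g x)" and \<epsilon>: "0 < \<epsilon>" "\<epsilon> \<le> 1"
    and params: "0 < \<theta>" "0 < \<rho>\<^sub>S" "\<rho>\<^sub>S < 1/2" "0 < \<rho>\<^sub>N" "\<rho>\<^sub>N < 1"
    and step: "gradient_step f g H \<epsilon> \<theta> \<rho>\<^sub>S \<rho>\<^sub>N x x'"
    and A1: "0 \<le> L\<^sub>g" "relevant_hessian_bounded g H L\<^sub>g"
    and A3: "0 < \<sigma>" "krylov_regular_I g H \<sigma>"
    and A4: "0 < \<omega>"
      "\<And>d. minres_returns (H x) (g x) (\<theta> * sqrt \<epsilon>) NPC d \<Longrightarrow> \<omega> * norm (g x) \<le> norm d"
    and c0: "c\<^sub>0 = 2 * \<sigma> / (\<theta> * L\<^sub>g + sqrt (\<theta>\<^sup>2 * L\<^sub>g\<^sup>2 + 2 * \<sigma>\<^sup>2 * L))"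
    and m: "0 < m" "m \<le> \<rho>\<^sub>S * \<sigma> * (3 * \<sigma> * (1 - 2 * \<rho>\<^sub>S) / L)\<^sup>2" "m \<le> \<rho>\<^sub>S * \<sigma> * c\<^sub>0\<^sup>2"
      "m \<le> \<rho>\<^sub>N * \<omega> powr (3/2) * sqrt (6 * (1 - \<rho>\<^sub>N) / L)"
  shows "f x' \<le> f x \<and> (m * \<epsilon> powr (3/2) \<le> f x - f x' \<or> norm (g x') \<le> \<epsilon>)"
proof -
  note sym = hessian_symmetric[of x]
  have \<epsilon>1: "\<epsilon> powr (3/2) \<le> 1" using \<epsilon> by (intro powr_le1) auto
  have \<epsilon>\<epsilon>: "\<epsilon> powr (3/2) \<le> \<epsilon>" using powr_mono'[of 1 "3/2" \<epsilon>] \<epsilon> by simp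
  obtain flag d \<alpha> where ret: "minres_returns (H x) (g x) (\<theta> * sqrt \<epsilon>) flag d"
    and ls: "case flag of
       SOL \<Rightarrow> is_largest (\<lambda>a. 0 < a \<and> a \<le> 1 \<and> f (x + a *\<^sub>R d) \<le> f x + \<rho>\<^sub>S * a * (g x \<bullet> d)) \<alpha>
     | NPC \<Rightarrow> is_largest (\<lambda>a. 0 < a \<and> f (x + a *\<^sub>R d) \<le> f x + \<rho>\<^sub>N * a * (g x \<bullet> d)) \<alpha>"
    and x': "x' = x + \<alpha> *\<^sub>R d"
    using step unfolding gradient_step_def by blast
  show ?thesis
  proof (cases flag)
    case NPC
    obtain n where n: "cr_no_npc (H x) (g x) n" "d = cr_residual (H x) (g x) n" "d \<noteq> 0"
      "d \<bullet> (H x *v d) \<le> 0"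
      by (rule minres_returns_NPC[OF sym ret[unfolded NPC]])
    have gd: "g x \<bullet> d = - (norm d)\<^sup>2"
      using cr_residual_inner_residual[OF sym n(1), of 0] by (simp add: n(2))
    have "is_largest (\<lambda>a. 0 < a \<and> f (x + a *\<^sub>R d) \<le> f x + \<rho>\<^sub>N * a * (g x \<bullet> d)) \<alpha>"
      using ls NPC by simp
    from NPC_decrease[OF this gd n(4,3) params(4,5)]
    have dec: "\<rho>\<^sub>N * sqrt (6 * (1 - \<rho>\<^sub>N) / L) * norm d powr (3/2) \<le> f x - f x'" by (simp only: x')
    have "\<omega> * \<epsilon> \<le> \<omega> * norm (g x)" using big A4(1) by simp
    also have "\<dots> \<le> norm d" using A4(2) ret NPC by simp
    finally have "(\<omega> * \<epsilon>) powr (3/2) \<le> norm d powr (3/2)" using A4(1) \<epsilon> by (intro powr_mono2) auto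
    then have "\<omega> powr (3/2) * \<epsilon> powr (3/2) \<le> norm d powr (3/2)" using A4(1) \<epsilon> by (simp add: powr_mult)
    then have "\<rho>\<^sub>N * sqrt (6 * (1 - \<rho>\<^sub>N) / L) * (\<omega> powr (3/2) * \<epsilon> powr (3/2))
        \<le> \<rho>\<^sub>N * sqrt (6 * (1 - \<rho>\<^sub>N) / L) * norm d powr (3/2)"
      using params L_pos by (intro mult_left_mono) auto
    moreover have "m * \<epsilon> powr (3/2)
        \<le> \<rho>\<^sub>N * \<omega> powr (3/2) * sqrt (6 * (1 - \<rho>\<^sub>N) / L) * \<epsilon> powr (3/2)"
      by (intro mult_right_mono m) simp
    ultimately have "m * \<epsilon> powr (3/2) \<le> f x - f x'" using dec by (simp add: ac_simps)
    moreover have "0 \<le> m * \<epsilon> powr (3/2)" using m(1) by simp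
    ultimately show ?thesis by simp
  next
    case SOL
    let ?r = "cr_residual (H x) (g x)"
    obtain n where np: "\<forall>i\<in>{1..Suc n}. \<not> npc_detected (H x) (g x) i"
      and no': "cr_no_npc (H x) (g x) (Suc n)" and d: "d = cr_iterate (H x) (g x) n"
      and acc: "norm (H x *v ?r n) \<le> \<theta> * sqrt \<epsilon> * norm (H x *v d)"
      by (rule minres_returns_SOL[OF sym ret[unfolded SOL]])
    have no: "cr_no_npc (H x) (g x) n" using no' by (simp add: cr_no_npc_def)
    have dK: "d \<in> krylov (H x) (g x) n" unfolding d by (rule cr_iterate_in_krylov[OF sym no])
    have rK: "?r n \<in> krylov (H x) (g x) (Suc n)"
      unfolding cr_residual_def using matrix_image_krylov[OF dK]
      by (intro subspace_diff subspace_neg subspace_krylov start_in_krylov) (simp add: d)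
    have r: "?r n = - g x - H x *v d" by (simp add: cr_residual_def d)
    have gd: "g x \<bullet> d \<le> - (d \<bullet> (H x *v d))"
      using cr_iterate_inner_residual_nonneg[OF sym no]
      by (simp add: d[symmetric] r inner_diff_right inner_commute)
    have pd: "d \<bullet> (H x *v d) \<ge> \<sigma> * (norm d)\<^sup>2"
      by (rule krylov_regular_I_all[OF A3(2) _ dK]) (use np in simp)
    have pr: "?r n \<bullet> (H x *v ?r n) \<ge> \<sigma> * (norm (?r n))\<^sup>2"
      by (rule krylov_regular_I_all[OF A3(2) np rK])
    have "is_largest (\<lambda>a. 0 < a \<and> a \<le> 1 \<and> f (x + a *\<^sub>R d) \<le> f x + \<rho>\<^sub>S * a * (g x \<bullet> d)) \<alpha>"
      using ls SOL by simp
    from SOL_decrease[OF this gd pd A3(1) params(2,3)]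
    consider (short) "\<rho>\<^sub>S * \<sigma> * (3 * \<sigma> * (1 - 2 * \<rho>\<^sub>S) / L)\<^sup>2 \<le> f x - f x'"
      | (full) "\<alpha> = 1" "\<rho>\<^sub>S * \<sigma> * (norm d)\<^sup>2 \<le> f x - f x'" unfolding x' by blast
    then show ?thesis
    proof cases
      case short
      have "m * \<epsilon> powr (3/2) \<le> m * 1" using m(1) \<epsilon>1 by (intro mult_left_mono) auto
      also have "\<dots> \<le> f x - f x'" using m(2) short by linarith
      finally have "m * \<epsilon> powr (3/2) \<le> f x - f x'" .
      moreover have "0 \<le> m * \<epsilon> powr (3/2)" using m(1) by simp
      ultimately show ?thesis by simp
    next
      case full
      have nonneg: "0 \<le> \<rho>\<^sub>S * \<sigma> * (norm d)\<^sup>2" using params A3(1) by simp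
      show ?thesis
      proof (cases "norm (g x') \<le> \<epsilon>")
        case True
        then show ?thesis using full nonneg by simp
      next
        case False
        obtain J U where JU: "relevant_eigenbasis (H x) (g x) J U"
          "spectral_norm (transpose U ** H x ** U) \<le> L\<^sub>g"
          using A1(2) unfolding relevant_hessian_bounded_def by blast
        have Hd: "norm (H x *v d) \<le> L\<^sub>g * norm d" by (rule relevant_bound_on_krylov[OF sym JU dK])
        have "\<sigma> * norm (?r n) \<le> norm (H x *v ?r n)"
        proof (cases "?r n = 0")
          case False
          have "\<sigma> * norm (?r n) * norm (?r n) \<le> norm (H x *v ?r n) * norm (?r n)"
            using pr norm_cauchy_schwarz[of "?r n" "H x *v ?r n"] by (simp add: power2_eq_square ac_simps)
          then show ?thesis using False by simp
        qed simp
        also have "\<dots> \<le> \<theta> * sqrt \<epsilon> * (L\<^sub>g * norm d)"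
          using acc Hd params \<epsilon> by (meson mult_left_mono mult_nonneg_nonneg less_imp_le order_trans real_sqrt_ge_zero)
        finally have rn: "norm (?r n) \<le> \<theta> * L\<^sub>g * sqrt \<epsilon> / \<sigma> * norm d"
          using A3(1) by (simp add: field_simps)
        have "g x' = (g (x + d) - g x - H x *v d) - ?r n" by (simp add: x' full(1) r)
        then have "norm (g x') \<le> norm (g (x + d) - g x - H x *v d) + norm (?r n)"
          by (metis norm_triangle_ineq4)
        also have "\<dots> \<le> L / 2 * (norm d)\<^sup>2 + \<theta> * L\<^sub>g * sqrt \<epsilon> / \<sigma> * norm d"
          by (intro add_mono gradient_taylor rn)
        finally have "(sqrt \<epsilon>)\<^sup>2 \<le> \<theta> * L\<^sub>g * sqrt \<epsilon> / \<sigma> * norm d + L / 2 * (norm d)\<^sup>2"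
          using False \<epsilon> by simp
        from positive_root_bound[OF A3(1) L_pos _ _ _ refl this]
        have "c\<^sub>0 * sqrt \<epsilon> \<le> norm d"
          using params A1(1) \<epsilon> by (simp add: c0 power_mult_distrib)
        moreover have "c\<^sub>0 \<ge> 0" using A3(1) params A1(1) L_pos by (simp add: c0)
        ultimately have "(c\<^sub>0 * sqrt \<epsilon>)\<^sup>2 \<le> (norm d)\<^sup>2" using \<epsilon> by (intro power_mono) auto
        then have "\<rho>\<^sub>S * \<sigma> * (c\<^sub>0\<^sup>2 * \<epsilon>) \<le> \<rho>\<^sub>S * \<sigma> * (norm d)\<^sup>2"
          using params A3(1) \<epsilon> by (intro mult_left_mono) (auto simp: power_mult_distrib)
        moreover have "m * \<epsilon> powr (3/2) \<le> \<rho>\<^sub>S * \<sigma> * c\<^sub>0\<^sup>2 * \<epsilon>"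
          using m \<epsilon>\<epsilon> by (intro mult_mono) auto
        ultimately have "m * \<epsilon> powr (3/2) \<le> f x - f x'" using full by (simp add: ac_simps)
        then show ?thesis using full nonneg by simp
      qed
    qed
  qed
qed

lemma curvature_step_progress:
  assumes step: "curvature_step f g H \<epsilon> \<rho> x u x'" and pos: "0 < \<epsilon>" "0 < \<rho>" "\<rho> < 1"
  shows "9 * \<rho> * (1 - \<rho>)\<^sup>2 / (16 * L\<^sup>2) * \<epsilon> ^ 3 \<le> f x - f x'"
proof -
  obtain r s d \<alpha> where ret: "minres_returns (H x + mat (\<epsilon> / 2)) u 0 NPC r"
    and s: "s \<in> {-1, 1}" "g x \<bullet> r \<noteq> 0 \<longrightarrow> s = sgn (g x \<bullet> r)"
    and d: "d = - (s / norm r) *\<^sub>R r"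
    and ls: "is_largest (\<lambda>a. 0 < a \<and>
          f (x + a *\<^sub>R d) \<le> f x + 1/2 * \<rho> * a\<^sup>2 * (d \<bullet> (H x *v d))) \<alpha>"
    and x': "x' = x + \<alpha> *\<^sub>R d"
    using step unfolding curvature_step_def by blast
  obtain n where "cr_no_npc (H x + mat (\<epsilon> / 2)) u n" "r = cr_residual (H x + mat (\<epsilon> / 2)) u n"
    and r0: "r \<noteq> 0" and npc: "r \<bullet> ((H x + mat (\<epsilon> / 2)) *v r) \<le> 0"
    by (rule minres_returns_NPC[OF symmetric_plus_mat[OF hessian_symmetric] ret])
  have ss: "s * s = 1" using s(1) by auto
  have "s * (g x \<bullet> r) \<ge> 0" using s(2) by (cases "g x \<bullet> r = 0") (auto simp: sgn_mult_abs[symmetric] sgn_if)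
  then have gd: "g x \<bullet> d \<le> 0" by (simp add: d)
  have nd: "norm d = 1" using r0 s(1) by (auto simp: d)
  have "r \<bullet> (H x *v r) \<le> - (\<epsilon> / 2) * (norm r)\<^sup>2"
    using npc by (simp add: matrix_vector_mult_add_rdistrib mat_mult_vec inner_add_right power2_norm_eq_inner)
  then have "r \<bullet> (H x *v r) / (norm r)\<^sup>2 \<le> - (\<epsilon> / 2)" using r0 by (simp add: pos_divide_le_eq)
  moreover have "d \<bullet> (H x *v d) = (s / norm r)\<^sup>2 * (r \<bullet> (H x *v r))"
    unfolding d matrix_vector_mult_scaleR by (simp add: power2_eq_square)
  ultimately have npc': "d \<bullet> (H x *v d) \<le> - (\<epsilon> / 2)" using ss by (simp add: power_divide power2_eq_square)
  show ?thesis
    unfolding x' by (rule curvature_decrease[OF ls gd npc' nd pos(2,3,1)])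
qed

section \<open>Counting steps\<close>

text \<open>
  The deterministic core. While no good point has been seen, the run cannot terminate, since passing
  the termination test with a draw that is not unlucky certifies the eigenvalue bound. A step with insufficient
  decrease ends at a small gradient, so the step after it follows negative curvature and makes up
  for it. Hence \<open>\<lfloor>(K + 1) / 2\<rfloor>\<close> pairs of steps each gain \<open>\<delta>\<close>, together more than the
  objective can lose.
\<close>

lemma run_reaches_second_order_point:
  assumes fmin: "\<And>x. fstar \<le> f x"
    and params: "0 < \<epsilon>\<^sub>g" "\<epsilon>\<^sub>g \<le> 1" "0 < \<epsilon>\<^sub>H" "0 < \<theta>"
      "0 < \<rho>\<^sub>S" "\<rho>\<^sub>S < 1/2" "0 < \<rho>\<^sub>N" "\<rho>\<^sub>N < 1" "0 < \<rho>\<^sub>C" "\<rho>\<^sub>C < 1"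
    and run: "newton_mr_run f g H \<epsilon>\<^sub>g \<epsilon>\<^sub>H \<theta> \<rho>\<^sub>S \<rho>\<^sub>N \<rho>\<^sub>C x\<^sub>0 u x"
    and lucky: "\<And>k. is_iterate g H \<epsilon>\<^sub>g \<epsilon>\<^sub>H u x k \<Longrightarrow> (x k, u k) \<notin> unlucky \<epsilon>\<^sub>H"
    and A1: "0 \<le> L\<^sub>g" "relevant_hessian_bounded g H L\<^sub>g"
    and A3: "0 < \<sigma>" "krylov_regular_I g H \<sigma>"
    and A4: "0 < \<omega>" "krylov_regular_II g H \<epsilon>\<^sub>g \<epsilon>\<^sub>H \<theta> \<omega> u x"
    and c0: "c\<^sub>0 = 2 * \<sigma> / (\<theta> * L\<^sub>g + sqrt (\<theta>\<^sup>2 * L\<^sub>g\<^sup>2 + 2 * \<sigma>\<^sup>2 * L))"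
    and m: "0 < m" "m \<le> \<rho>\<^sub>S * \<sigma> * (3 * \<sigma> * (1 - 2 * \<rho>\<^sub>S) / L)\<^sup>2" "m \<le> \<rho>\<^sub>S * \<sigma> * c\<^sub>0\<^sup>2"
      "m \<le> \<rho>\<^sub>N * \<omega> powr (3/2) * sqrt (6 * (1 - \<rho>\<^sub>N) / L)"
      "m \<le> 9 * \<rho>\<^sub>C * (1 - \<rho>\<^sub>C)\<^sup>2 / (16 * L\<^sup>2)"
    and K: "2 * (f x\<^sub>0 - fstar) / m * max (\<epsilon>\<^sub>g powr (-3/2)) (\<epsilon>\<^sub>H powr (-3)) + 1 \<le> of_int K"
  shows "\<exists>k. int k \<le> K \<and> is_iterate g H \<epsilon>\<^sub>g \<epsilon>\<^sub>H u x k \<and>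
           norm (g (x k)) \<le> \<epsilon>\<^sub>g \<and> lambda_min (H (x k)) \<ge> - \<epsilon>\<^sub>H"
proof (rule ccontr)
  assume none: "\<not> ?thesis"
  let ?it = "is_iterate g H \<epsilon>\<^sub>g \<epsilon>\<^sub>H u x"
  define \<delta> where "\<delta> = m * min (\<epsilon>\<^sub>g powr (3/2)) (\<epsilon>\<^sub>H ^ 3)"
  have \<delta>: "\<delta> > 0" using m(1) params by (simp add: \<delta>_def)
  have it: "?it k" if "int k \<le> K + 1" for k
    using that
  proof (induction k)
    case (Suc k)
    then have k: "?it k" "int k \<le> K" by simp_all
    have "\<not> newton_mr_terminates g H \<epsilon>\<^sub>g \<epsilon>\<^sub>H (x k) (u k)"
    proof
      assume "newton_mr_terminates g H \<epsilon>\<^sub>g \<epsilon>\<^sub>H (x k) (u k)"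
      then obtain d where small: "norm (g (x k)) \<le> \<epsilon>\<^sub>g"
        and ret: "minres_returns (H (x k) + mat (\<epsilon>\<^sub>H / 2)) (u k) 0 SOL d"
        unfolding newton_mr_terminates_def by blast
      have "\<nexists>v. v \<bullet> (H (x k) *v v) < - \<epsilon>\<^sub>H * (norm v)\<^sup>2"
        using lucky[OF k(1)] minres_SOL_imp_krylov_psd[OF symmetric_plus_mat[OF hessian_symmetric] ret]
        unfolding unlucky_def mem_Collect_eq fst_conv snd_conv by blast
      then have "lambda_min (H (x k)) \<ge> - \<epsilon>\<^sub>H"
        by (intro lambda_min_ge hessian_symmetric) (meson not_less)
      then show False using none k small by blast
    qed
    then show ?case using k by (simp add: is_iterate_Suc)
  qed (simp add: is_iterate_def)
  have step: "f (x (Suc k)) \<le> f (x k) \<and>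
      (\<delta> \<le> f (x k) - f (x (Suc k)) \<or> norm (g (x k)) > \<epsilon>\<^sub>g \<and> norm (g (x (Suc k))) \<le> \<epsilon>\<^sub>g)"
    if k: "int k \<le> K" for k
  proof -
    have ik: "?it k" and "?it (Suc k)" using it[of k] it[of "Suc k"] k by simp_all
    then have st: "newton_mr_step f g H \<epsilon>\<^sub>g \<epsilon>\<^sub>H \<theta> \<rho>\<^sub>S \<rho>\<^sub>N \<rho>\<^sub>C (x k) (u k) (x (Suc k))"
      using run unfolding newton_mr_run_def by blast
    show ?thesis
    proof (cases "norm (g (x k)) > \<epsilon>\<^sub>g")
      case True
      have gs: "gradient_step f g H \<epsilon>\<^sub>g \<theta> \<rho>\<^sub>S \<rho>\<^sub>N (x k) (x (Suc k))"
        using st True by (simp add: newton_mr_step_def)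
      have nd: "\<omega> * norm (g (x k)) \<le> norm d"
        if "minres_returns (H (x k)) (g (x k)) (\<theta> * sqrt \<epsilon>\<^sub>g) NPC d" for d
        using A4(2) ik True that unfolding krylov_regular_II_def by blast
      have "\<delta> \<le> m * \<epsilon>\<^sub>g powr (3/2)" unfolding \<delta>_def using m(1) by (intro mult_left_mono) auto
      with gradient_step_progress[OF True params(1,2,4-8) gs A1 A3 A4(1) nd c0 m(1-4)] True
      show ?thesis by linarith
    next
      case False
      then have cs: "curvature_step f g H \<epsilon>\<^sub>H \<rho>\<^sub>C (x k) (u k) (x (Suc k))"
        using st by (simp add: newton_mr_step_def)
      have "\<delta> \<le> 9 * \<rho>\<^sub>C * (1 - \<rho>\<^sub>C)\<^sup>2 / (16 * L\<^sup>2) * \<epsilon>\<^sub>H ^ 3"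
        unfolding \<delta>_def using m(1,5) params by (intro mult_mono) auto
      with curvature_step_progress[OF cs params(3,9,10)] \<delta> show ?thesis by linarith
    qed
  qed
  have two: "\<delta> \<le> f (x k) - f (x (k + 2))" if "int k + 1 \<le> K" for k
    using step[of k] step[of "Suc k"] that by force
  have many: "real j * \<delta> \<le> f x\<^sub>0 - f (x (2 * j))" if "2 * int j \<le> K + 1" for j
    using that
  proof (induction j)
    case 0
    then show ?case using run by (simp add: newton_mr_run_def)
  next
    case (Suc j)
    then show ?case using two[of "2 * j"] by (simp add: algebra_simps)
  qed
  define N where "N = nat K"
  have max_eq: "max (\<epsilon>\<^sub>g powr (-3/2)) (\<epsilon>\<^sub>H powr (-3)) = 1 / min (\<epsilon>\<^sub>g powr (3/2)) (\<epsilon>\<^sub>H ^ 3)"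
  proof -
    have 1: "\<epsilon>\<^sub>g powr (-3/2) = 1 / \<epsilon>\<^sub>g powr (3/2)" using powr_minus_divide[of \<epsilon>\<^sub>g "3/2"] by simp
    have 2: "\<epsilon>\<^sub>H powr (-3) = 1 / \<epsilon>\<^sub>H ^ 3"
      using powr_minus_divide[of \<epsilon>\<^sub>H 3] params by (simp add: powr_numeral)
    have 3: "max (1 / a) (1 / b) = 1 / min a b" if "0 < a" "0 < b" for a b :: real
      using that by (simp add: max_def min_def frac_le divide_le_cancel) (auto simp: field_simps)
    show ?thesis unfolding 1 2 by (rule 3) (use params in auto)
  qed
  have K': "2 * (f x\<^sub>0 - fstar) / \<delta> + 1 \<le> of_int K"
    using K unfolding max_eq \<delta>_def times_divide_times_eq mult_1_right .
  have "0 \<le> 2 * (f x\<^sub>0 - fstar) / \<delta>" using fmin \<delta> by simp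
  then have "K \<ge> 1" using K' by linarith
  then have KN: "K = int N" by (simp add: N_def)
  define j where "j = (N + 1) div 2"
  have "2 * j \<le> N + 1" "N \<le> 2 * j" by (simp_all add: j_def)
  then have "real j * \<delta> \<le> f x\<^sub>0 - f (x (2 * j))" by (intro many) (simp add: KN)
  also have "\<dots> \<le> f x\<^sub>0 - fstar" using fmin by simp
  finally have "2 * real j * \<delta> \<le> 2 * (f x\<^sub>0 - fstar)" by simp
  moreover have "(2 * (f x\<^sub>0 - fstar) / \<delta> + 1) * \<delta> \<le> 2 * real j * \<delta>"
    using K' \<open>N \<le> 2 * j\<close> \<delta> by (intro mult_right_mono) (auto simp: KN)
  moreover have "(2 * (f x\<^sub>0 - fstar) / \<delta> + 1) * \<delta> = 2 * (f x\<^sub>0 - fstar) + \<delta>"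
    using \<delta> by (simp add: distrib_right)
  ultimately show False using \<delta> by linarith
qed

end

theorem theorem5:
  fixes f :: "real^'d \<Rightarrow> real" and g :: "real^'d \<Rightarrow> real^'d" and H :: "real^'d \<Rightarrow> real^'d^'d"
    and x\<^sub>0 :: "real^'d" and fstar :: real
    and \<epsilon>\<^sub>g \<epsilon>\<^sub>H \<theta> \<rho>\<^sub>S \<rho>\<^sub>N \<rho>\<^sub>C L\<^sub>g L\<^sub>H \<sigma> \<omega> c\<^sub>0 c\<^sub>1 c\<^sub>2 c\<^sub>3 c\<^sub>4 :: real and K :: int
    and M :: "'w measure" and G X :: "nat \<Rightarrow> 'w \<Rightarrow> real^'d"
  assumes grad: "\<And>x. GDERIV f x :> g x"
    and hess: "\<And>x. (g has_derivative (\<lambda>h. H x *v h)) (at x)"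
    and hess_cont: "continuous_on UNIV H"
    and fmin: "fstar \<in> range f" "\<And>x. fstar \<le> f x"
    and params: "0 < \<epsilon>\<^sub>g" "\<epsilon>\<^sub>g \<le> 1" "0 < \<epsilon>\<^sub>H" "\<epsilon>\<^sub>H \<le> 1" "0 < \<theta>"
      "0 < \<rho>\<^sub>S" "\<rho>\<^sub>S < 1/2" "0 < \<rho>\<^sub>N" "\<rho>\<^sub>N < 1" "0 < \<rho>\<^sub>C" "\<rho>\<^sub>C < 1"
    and draws: "prob_space M"
      "prob_space.indep_vars M (\<lambda>_. borel) G UNIV"
      "\<And>k. distr M borel (G k) = uniform_sphere"
    and run: "AE w in M. newton_mr_run f g H \<epsilon>\<^sub>g \<epsilon>\<^sub>H \<theta> \<rho>\<^sub>S \<rho>\<^sub>N \<rho>\<^sub>C x\<^sub>0 (\<lambda>k. G k w) (\<lambda>k. X k w)"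
    and A1: "0 \<le> L\<^sub>g" "relevant_hessian_bounded g H L\<^sub>g"
    and A2: "0 < L\<^sub>H" "hessian_lipschitz H L\<^sub>H"
    and A3: "0 < \<sigma>" "krylov_regular_I g H \<sigma>"
    and A4: "0 < \<omega>"
      "AE w in M. krylov_regular_II g H \<epsilon>\<^sub>g \<epsilon>\<^sub>H \<theta> \<omega> (\<lambda>k. G k w) (\<lambda>k. X k w)"
    and c0: "c\<^sub>0 = 2 * \<sigma> / (\<theta> * L\<^sub>g + sqrt (\<theta>\<^sup>2 * L\<^sub>g\<^sup>2 + 2 * \<sigma>\<^sup>2 * L\<^sub>H))"
    and c1: "c\<^sub>1 = \<rho>\<^sub>S * \<sigma> * (3 * \<sigma> * (1 - 2 * \<rho>\<^sub>S) / L\<^sub>H)\<^sup>2"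
    and c2: "c\<^sub>2 = \<rho>\<^sub>S * \<sigma> * c\<^sub>0\<^sup>2"
    and c3: "c\<^sub>3 = \<rho>\<^sub>N * \<omega> powr (3/2) * sqrt (6 * (1 - \<rho>\<^sub>N) / L\<^sub>H)"
    and c4: "c\<^sub>4 = 9 * \<rho>\<^sub>C * (1 - \<rho>\<^sub>C)\<^sup>2 / (16 * L\<^sub>H\<^sup>2)"
    and K: "K = \<lceil>2 * (f x\<^sub>0 - fstar) / Min {c\<^sub>1, c\<^sub>2, c\<^sub>3, c\<^sub>4}
                  * max (\<epsilon>\<^sub>g powr (-3/2)) (\<epsilon>\<^sub>H powr (-3)) + 1\<rceil>"
  shows "AE w in M. \<exists>k. int k \<le> K \<and>
           is_iterate g H \<epsilon>\<^sub>g \<epsilon>\<^sub>H (\<lambda>j. G j w) (\<lambda>j. X j w) k \<and>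
           norm (g (X k w)) \<le> \<epsilon>\<^sub>g \<and> lambda_min (H (X k w)) \<ge> - \<epsilon>\<^sub>H"
proof -
  interpret prob_space M by (rule draws(1))
  interpret lipschitz_hessian f g H L\<^sub>H
    by unfold_locales (fact grad hess hess_cont A2)+
  define m where "m = Min {c\<^sub>1, c\<^sub>2, c\<^sub>3, c\<^sub>4}"
  have c0_pos: "0 < c\<^sub>0"
  proof -
    have "0 < sqrt (\<theta>\<^sup>2 * L\<^sub>g\<^sup>2 + 2 * \<sigma>\<^sup>2 * L\<^sub>H)"
      using A2(1) A3(1) by (simp add: add_nonneg_pos)
    then show ?thesis
      unfolding c0 using A1(1) A3(1) params(5) by (intro divide_pos_pos add_nonneg_pos) auto
  qed
  have m: "0 < m" "m \<le> c\<^sub>1" "m \<le> c\<^sub>2" "m \<le> c\<^sub>3" "m \<le> c\<^sub>4"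
    unfolding m_def using c0_pos params A2(1) A3(1) A4(1) by (simp_all add: c1 c2 c3 c4)
  have K': "2 * (f x\<^sub>0 - fstar) / m * max (\<epsilon>\<^sub>g powr (-3/2)) (\<epsilon>\<^sub>H powr (-3)) + 1 \<le> of_int K"
    unfolding K m_def by (rule le_of_int_ceiling)
  obtain T where T: "countable T" "T \<subseteq> borel_measurable borel"
    and stepT: "\<forall>x u x'. newton_mr_step f g H \<epsilon>\<^sub>g \<epsilon>\<^sub>H \<theta> \<rho>\<^sub>S \<rho>\<^sub>N \<rho>\<^sub>C x u x' \<longrightarrow>
      (\<exists>h\<in>T. x' = h (x, u))"
    by (rule countable_step_maps)
  have "AE w in M. \<forall>x k. x 0 = x\<^sub>0 \<longrightarrow> (\<forall>j<k. \<exists>h\<in>T. x (Suc j) = h (x j, G j w)) \<longrightarrow>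
      (x k, G k w) \<notin> unlucky \<epsilon>\<^sub>H"
    by (rule AE_run_avoids[OF draws(2,3) T unlucky_borel AE_not_unlucky[OF params(3)]])
  with run A4(2) show ?thesis
  proof eventually_elim
    fix w
    assume run: "newton_mr_run f g H \<epsilon>\<^sub>g \<epsilon>\<^sub>H \<theta> \<rho>\<^sub>S \<rho>\<^sub>N \<rho>\<^sub>C x\<^sub>0 (\<lambda>k. G k w) (\<lambda>k. X k w)"
      and A4w: "krylov_regular_II g H \<epsilon>\<^sub>g \<epsilon>\<^sub>H \<theta> \<omega> (\<lambda>k. G k w) (\<lambda>k. X k w)"
      and avoid: "\<forall>x k. x 0 = x\<^sub>0 \<longrightarrow> (\<forall>j<k. \<exists>h\<in>T. x (Suc j) = h (x j, G j w)) \<longrightarrow>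
        (x k, G k w) \<notin> unlucky \<epsilon>\<^sub>H"
    have lucky: "(X k w, G k w) \<notin> unlucky \<epsilon>\<^sub>H"
      if it: "is_iterate g H \<epsilon>\<^sub>g \<epsilon>\<^sub>H (\<lambda>k. G k w) (\<lambda>k. X k w) k" for k
    proof (rule avoid[rule_format, of "\<lambda>k. X k w" k])
      show "X 0 w = x\<^sub>0" using run by (simp add: newton_mr_run_def)
      fix j assume "j < k"
      then have "is_iterate g H \<epsilon>\<^sub>g \<epsilon>\<^sub>H (\<lambda>k. G k w) (\<lambda>k. X k w) (Suc j)"
        using is_iterate_antimono[OF it, of "Suc j"] by simp
      then show "\<exists>h\<in>T. X (Suc j) w = h (X j w, G j w)"
        using run unfolding newton_mr_run_def by (intro stepT[rule_format]) blast
    qed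
    show "\<exists>k. int k \<le> K \<and> is_iterate g H \<epsilon>\<^sub>g \<epsilon>\<^sub>H (\<lambda>j. G j w) (\<lambda>j. X j w) k \<and>
           norm (g (X k w)) \<le> \<epsilon>\<^sub>g \<and> lambda_min (H (X k w)) \<ge> - \<epsilon>\<^sub>H"
      by (rule run_reaches_second_order_point[OF fmin(2) params(1-3,5-11) run lucky A1 A3 A4(1) A4w c0
            m(1) m(2)[unfolded c1] m(3)[unfolded c2] m(4)[unfolded c3] m(5)[unfolded c4] K'])
  qed
qed

end
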